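(* Let $p\ge 1$ be an integer and $q\ge 4$ an even integer. If $H$ is a graph that is $L$-cospectral to the jellyfish graph $JFG(p,q)$, then $H$ is DLS.
   Context: All graphs are finite and simple. The jellyfish graph $JFG(p,q)$ is obtained from a cycle $C_q$ and $q$ copies of the star $K_{1,p}$ by identifying each vertex of $C_q$ with the center (vertex of maximum degree) of a distinct copy of $K_{1,p}$. The Laplacian matrix of a graph is $L(G)=D(G)-A(G)$, where $A(G)$ is the adjacency matrix and $D(G)$ the diagonal degree matrix. Two graphs are $L$-cospectral if their Laplacian matrices have the same spectrum. A graph is DLS (determined by its Laplacian spectrum) if every graph $L$-cospectral with it is isomorphic to it. *)

theory Defs
  imports "Jordan_Normal_Form.Char_Poly"
begin

text \<open>A finite simple graph is represented as a pair (n, E): the vertex set is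
  {0..<n} and E is a set of 2-element subsets of {0..<n}. Every finite simple graph
  is isomorphic to such a graph.\<close>

type_synonym graph = "nat \<times> nat set set"

definition verts :: "graph \<Rightarrow> nat set" where
  "verts G = {0..<fst G}"

definition edges :: "graph \<Rightarrow> nat set set" where
  "edges G = snd G"

definition wf_graph :: "graph \<Rightarrow> bool" where
  "wf_graph G \<longleftrightarrow> (\<forall>e\<in>edges G. e \<subseteq> verts G \<and> card e = 2)"

definition adj :: "graph \<Rightarrow> nat \<Rightarrow> nat \<Rightarrow> bool" where
  "adj G u v \<longleftrightarrow> {u, v} \<in> edges G"

definition degree :: "graph \<Rightarrow> nat \<Rightarrow> nat" where
  "degree G v = card {u \<in> verts G. adj G u v}"

definition laplacian :: "graph \<Rightarrow> real mat" where
  "laplacian G = mat (fst G) (fst G)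
     (\<lambda>(i, j). (if i = j then real (degree G i) else 0) - (if adj G i j then 1 else 0))"

definition L_spectrum :: "graph \<Rightarrow> complex \<Rightarrow> nat" where
  "L_spectrum G = (\<lambda>a. order a (map_poly complex_of_real (char_poly (laplacian G))))"

definition L_cospectral :: "graph \<Rightarrow> graph \<Rightarrow> bool" where
  "L_cospectral G H \<longleftrightarrow> L_spectrum G = L_spectrum H"

definition graph_iso :: "graph \<Rightarrow> graph \<Rightarrow> bool" where
  "graph_iso G H \<longleftrightarrow> (\<exists>f. bij_betw f (verts G) (verts H) \<and>
      (\<forall>u\<in>verts G. \<forall>v\<in>verts G. adj G u v \<longleftrightarrow> adj H (f u) (f v)))"

definition DLS :: "graph \<Rightarrow> bool" where
  "DLS G \<longleftrightarrow> (\<forall>H. wf_graph H \<and> L_cospectral H G \<longrightarrow> graph_iso H G)"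

text \<open>Jellyfish graph JFG(p,q): cycle vertices 0..q-1 (i adjacent to (i+1) mod q);
  pendant vertex q + i*p + j (j < p) attached to cycle vertex i.\<close>
definition jfg :: "nat \<Rightarrow> nat \<Rightarrow> graph" where
  "jfg p q = (q + q * p,
     {{i, (i + 1) mod q} | i. i < q} \<union>
     {{i, q + i * p + j} | i j. i < q \<and> j < p})"

end

(*
  The Laplacian traces of orders 1, 2, 3, the simplicity of the eigenvalue 0 (cospectral graphs are
  connected) and the bound on the largest eigenvalue by p + 5 (maximum degree at most p + 3) make
  the sum of (d - 1)(p + 2 - d)(p + 3 - d) over all degrees d equal to 6t, where t <= 1 is the number
  of triangles; all its terms are nonnegative, so the degrees are 1 and p + 2, up to one exceptional
  degree sequence with p = 1 and t = 1.  Eliminating the leaves from det(x - L) and letting x tend to 1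
  excludes that sequence by a sign argument, and otherwise shows that the numbers b_v of
  leaves at the q vertices of degree p + 2 have product p^q.  Their sum is pq, so equality in AM-GM
  gives b_v = p: what remains after removing the leaves is connected and 2-regular, hence a q-cycle.
*)

theory Submission
  imports Defs "Jordan_Normal_Form.Schur_Decomposition" "HOL-Analysis.Convex"
begin

section \<open>Spectra and traces\<close>

text \<open>The third trace brings in the triangles of the cospectral graph, so nonnegativity must
  come from the choice of the cubic: its roots are the two jellyfish degrees and
  \<open>p + 3\<close>, the largest degree the spectrum allows. That limit arises because every
  jellyfish eigenvalue is strictly below \<open>p + 5\<close>, while the largest Laplacian
  eigenvalue is at least one more than any positive degree. There is at most one triangle because
  the first trace gives as many edges as vertices.

  The degrees do not yet tell how the leaves are distributed. Leaves show up at the eigenvalue 1: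
  eliminating them produces powers of \<open>x - 1\<close>, and these must be cancelled before
  \<open>x = 1\<close> can be inserted. Comparing the exponents determines the number of vertices
  that carry a leaf. If all vertices of degree \<open>p + 2\<close> do, the remaining determinant at
  1 is diagonal and equals, up to sign, the product of the leaf counts. In the exceptional sequence
  (\<open>p = 1\<close>, with one vertex of degree 4, three of degree 2, and \<open>q - 1\<close>
  leaves) exactly two vertices are neither leaves nor next to one, and a 2 by 2 block
  remains.\<close>

definition trace :: "'a::comm_monoid_add mat \<Rightarrow> 'a" where
  "trace A = (\<Sum>i<dim_row A. A $$ (i, i))"

lemma mat_mult_index_sum:
  assumes "A \<in> carrier_mat n m" and "B \<in> carrier_mat m l" and "i < n" and "j < l"
  shows "(A * B) $$ (i, j) = (\<Sum>k<m. A $$ (i, k) * B $$ (k, j))"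
  using assms by (auto simp: scalar_prod_def atLeast0LessThan)

lemma trace_mult_commute:
  fixes A :: "'a::comm_semiring_0 mat"
  assumes A: "A \<in> carrier_mat n m" and B: "B \<in> carrier_mat m n"
  shows "trace (A * B) = trace (B * A)"
proof -
  have "trace (A * B) = (\<Sum>i<n. \<Sum>k<m. A $$ (i, k) * B $$ (k, i))"
    unfolding trace_def using A by (auto intro!: sum.cong simp: mat_mult_index_sum[OF A B])
  also have "\<dots> = (\<Sum>k<m. \<Sum>i<n. B $$ (k, i) * A $$ (i, k))"
    by (subst sum.swap) (simp add: mult.commute)
  also have "\<dots> = trace (B * A)"
    unfolding trace_def using B by (auto intro!: sum.cong simp: mat_mult_index_sum[OF B A])
  finally show ?thesis .
qed

lemma upper_triangular_pow:
  fixes B :: "'a::comm_ring_1 mat"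
  assumes B: "B \<in> carrier_mat n n" and ut: "upper_triangular B"
  shows "upper_triangular (B ^\<^sub>m k) \<and> (\<forall>i<n. (B ^\<^sub>m k) $$ (i, i) = B $$ (i, i) ^ k)"
proof (induction k)
  case 0
  then show ?case using B by auto
next
  case (Suc k)
  have C: "B ^\<^sub>m k \<in> carrier_mat n n" using B by simp
  have z: "B $$ (i, j) = 0" if "j < i" "i < n" for i j
    using ut that B by auto
  have zk: "(B ^\<^sub>m k) $$ (i, j) = 0" if "j < i" "i < n" for i j
    using Suc that C by auto
  have "(\<Sum>l<n. (B ^\<^sub>m k) $$ (i, l) * B $$ (l, j)) = 0" if "j < i" "i < n" for i j
  proof (rule sum.neutral, rule ballI)
    fix l assume "l \<in> {..<n}"
    then show "(B ^\<^sub>m k) $$ (i, l) * B $$ (l, j) = 0"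
      using z[of j l] zk[of l i] that by (cases "l < i") auto
  qed
  moreover have "(\<Sum>l<n. (B ^\<^sub>m k) $$ (i, l) * B $$ (l, i)) = B $$ (i, i) ^ Suc k" if "i < n" for i
  proof -
    have "(\<Sum>l<n. (B ^\<^sub>m k) $$ (i, l) * B $$ (l, i)) =
        (\<Sum>l\<in>{i}. (B ^\<^sub>m k) $$ (i, l) * B $$ (l, i))"
    proof (rule sum.mono_neutral_right)
      show "\<forall>l\<in>{..<n} - {i}. (B ^\<^sub>m k) $$ (i, l) * B $$ (l, i) = 0"
        using z[of i] zk[of _ i] that by (metis Diff_iff insertI1 lessThan_iff linorder_neqE_nat mult_not_zero)
    qed (use that in auto)
    then show ?thesis using Suc that by (simp add: mult.commute)
  qed
  ultimately show ?case
    using B C mat_mult_index_sum[OF C B]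
    by (intro conjI upper_triangularI) (auto simp del: index_mult_mat(1))
qed

text \<open>Schur decomposition makes \<open>A\<close> similar to a triangular matrix with the
  eigenvalues \<open>as\<close> on its diagonal. Powers of that matrix carry the powers of
  \<open>as\<close> on the diagonal, and cyclicity of the trace removes the similarity.\<close>

lemma trace_pow_eq_power_sum:
  fixes A :: "complex mat"
  assumes A: "A \<in> carrier_mat n n" and cp: "char_poly A = (\<Prod>a\<leftarrow>as. [:- a, 1:])"
  shows "trace (A ^\<^sub>m k) = (\<Sum>a\<leftarrow>as. a ^ k)"
proof -
  obtain B P Q where s: "schur_decomposition A as = (B, P, Q)"
    by (cases "schur_decomposition A as") auto
  from schur_decomposition[OF A cp s] have w: "similar_mat_wit A B P Q"
    and ut: "upper_triangular B" and dg: "diag_mat B = as" by auto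
  from similar_mat_witD2[OF A w] have B: "B \<in> carrier_mat n n" and P: "P \<in> carrier_mat n n"
    and Q: "Q \<in> carrier_mat n n" by auto
  from similar_mat_witD2[OF _ similar_mat_wit_pow[OF w, of k], of n n] A
  have e: "A ^\<^sub>m k = P * B ^\<^sub>m k * Q" and qp: "Q * P = 1\<^sub>m n" by auto
  have Bk: "B ^\<^sub>m k \<in> carrier_mat n n" using B by simp
  have "trace (A ^\<^sub>m k) = trace (Q * (P * B ^\<^sub>m k))"
    unfolding e by (rule trace_mult_commute) (use P Q Bk in auto)
  also have "Q * (P * B ^\<^sub>m k) = B ^\<^sub>m k"
    using assoc_mult_mat[OF Q P Bk] left_mult_one_mat[OF Bk] qp by metis
  also have "trace (B ^\<^sub>m k) = (\<Sum>i<n. B $$ (i, i) ^ k)"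
    unfolding trace_def using upper_triangular_pow[OF B ut, of k] B by auto
  also have "\<dots> = (\<Sum>a\<leftarrow>as. a ^ k)"
    unfolding dg[symmetric] diag_mat_def using B
    by (simp add: comp_def interv_sum_list_conv_sum_set_nat atLeast0LessThan)
  finally show ?thesis .
qed

lemma trace_hom_pow:
  fixes A :: "real mat"
  assumes A: "A \<in> carrier_mat n n"
  shows "trace (map_mat complex_of_real A ^\<^sub>m k) = complex_of_real (trace (A ^\<^sub>m k))"
proof -
  have "map_mat complex_of_real (A ^\<^sub>m k) = map_mat complex_of_real A ^\<^sub>m k"
    by (rule of_real_hom.mat_hom_pow[OF A])
  then show ?thesis
    unfolding trace_def using A by (simp flip: \<open>map_mat complex_of_real (A ^\<^sub>m k) = _\<close>)
qed

text \<open>Over the complex numbers the common characteristic polynomial splits, and one list of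
  roots computes the traces of both matrices.\<close>

lemma trace_pow_cong:
  fixes A B :: "real mat"
  assumes A: "A \<in> carrier_mat n n" and B: "B \<in> carrier_mat n n" and cp: "char_poly A = char_poly B"
  shows "trace (A ^\<^sub>m k) = trace (B ^\<^sub>m k)"
proof -
  let ?h = "map_mat complex_of_real"
  have cpc: "char_poly (?h A) = char_poly (?h B)"
    using of_real_hom.char_poly_hom[OF A] of_real_hom.char_poly_hom[OF B] cp by metis
  have hA: "?h A \<in> carrier_mat n n" and hB: "?h B \<in> carrier_mat n n" using A B by auto
  from char_poly_factorized[OF hA] obtain as where as: "char_poly (?h A) = (\<Prod>a\<leftarrow>as. [:- a, 1:])" by auto
  have "trace (?h A ^\<^sub>m k) = trace (?h B ^\<^sub>m k)"
    using trace_pow_eq_power_sum[OF hA as] trace_pow_eq_power_sum[OF hB as[unfolded cpc]] by metis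
  then show ?thesis
    unfolding trace_hom_pow[OF A] trace_hom_pow[OF B] by simp
qed

lemma trace_pow_bound:
  fixes A :: "real mat"
  assumes A: "A \<in> carrier_mat n n"
    and ev: "\<And>l. eigenvalue (map_mat complex_of_real A) l \<Longrightarrow> cmod l \<le> r"
  shows "\<bar>trace (A ^\<^sub>m k)\<bar> \<le> real n * r ^ k"
proof -
  let ?h = "map_mat complex_of_real"
  have hA: "?h A \<in> carrier_mat n n" using A by auto
  from char_poly_factorized[OF hA] obtain as where as: "char_poly (?h A) = (\<Prod>a\<leftarrow>as. [:- a, 1:])"
    and len: "length as = n" by auto
  have le: "cmod a \<le> r" if "a \<in> set as" for a
    using that by (intro ev, unfold eigenvalue_root_char_poly[OF hA] as poly_prod_list)
      (auto simp: prod_list_zero_iff)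
  have "cmod (\<Sum>a\<leftarrow>bs. a ^ k) \<le> real (length bs) * r ^ k" if "set bs \<subseteq> set as" for bs
    using that
  proof (induction bs)
    case (Cons a bs)
    have "cmod (a ^ k) \<le> r ^ k"
      using le[of a] Cons.prems by (auto simp: norm_power intro: power_mono)
    then show ?case
      using Cons norm_triangle_ineq[of "a ^ k" "\<Sum>a\<leftarrow>bs. a ^ k"] by (auto simp: algebra_simps)
  qed simp
  then show ?thesis
    using trace_pow_eq_power_sum[OF hA as, of k] len unfolding trace_hom_pow[OF A] 
    by (metis norm_of_real order_refl)
qed

section \<open>From root multiplicities to the characteristic polynomial\<close>

lemma complex_poly_eqI_order:
  fixes f g :: "complex poly"
  assumes "lead_coeff f = lead_coeff g" and "f \<noteq> 0" and "g \<noteq> 0" and "\<And>a. Polynomial.order a f = Polynomial.order a g"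
  shows "f = g"
proof -
  have "poly f z = 0 \<longleftrightarrow> poly g z = 0" for z
    using assms by (simp add: order_root)
  then have "Polynomial.smult (lead_coeff f) (\<Prod>z|poly f z = 0. [:-z, 1:] ^ Polynomial.order z f) =
    Polynomial.smult (lead_coeff g) (\<Prod>z|poly g z = 0. [:-z, 1:] ^ Polynomial.order z g)"
    using assms by simp
  then show ?thesis by (simp only: complex_poly_decompose)
qed

lemma laplacian_carrier[simp]: "laplacian G \<in> carrier_mat (fst G) (fst G)"
  by (simp add: laplacian_def)

text \<open>Cospectrality is given by complex root multiplicities; these determine a monic
  polynomial, and the embedding of the reals is injective on coefficients. All later spectral
  comparisons use this polynomial identity.\<close>

lemma L_cospectral_char_poly:
  assumes "L_cospectral G H"
  shows "char_poly (laplacian G) = char_poly (laplacian H)"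
proof -
  let ?c = "\<lambda>G. map_poly complex_of_real (char_poly (laplacian G))"
  have m: "monic (?c K)" "?c K \<noteq> 0" for K
    using degree_monic_char_poly[OF laplacian_carrier, of K] by auto
  have "?c G = ?c H"
    by (rule complex_poly_eqI_order)
      (use m assms in \<open>auto simp: L_cospectral_def L_spectrum_def fun_eq_iff\<close>)
  then show ?thesis by (simp add: poly_eq_iff coeff_map_poly)
qed

lemma L_cospectral_order:
  assumes "L_cospectral G H"
  shows "fst G = fst H"
  using L_cospectral_char_poly[OF assms] degree_monic_char_poly[OF laplacian_carrier]
  by metis

section \<open>The Laplacian matrix and connectedness\<close>

definition nbrs :: "graph \<Rightarrow> nat \<Rightarrow> nat set" where
  "nbrs G v = {u \<in> verts G. adj G v u}"

lemma adj_commute: "adj G u v \<longleftrightarrow> adj G v u"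
  by (simp add: adj_def insert_commute)

lemma adj_irrefl: "wf_graph G \<Longrightarrow> \<not> adj G u u"
  by (auto simp: wf_graph_def adj_def)

lemma adj_verts: "wf_graph G \<Longrightarrow> adj G u v \<Longrightarrow> u \<in> verts G \<and> v \<in> verts G"
  by (auto simp: wf_graph_def adj_def)

lemma finite_verts[simp]: "finite (verts G)"
  by (simp add: verts_def)

lemma finite_nbrs[simp]: "finite (nbrs G v)"
  by (simp add: nbrs_def)

lemma degree_eq_card_nbrs: "degree G v = card (nbrs G v)"
  by (simp add: degree_def nbrs_def adj_commute)

lemma mem_nbrs: "wf_graph G \<Longrightarrow> u \<in> nbrs G v \<longleftrightarrow> adj G v u"
  using adj_verts[of G v u] by (auto simp: nbrs_def adj_commute)

lemma sum_adj:
  fixes f :: "nat \<Rightarrow> 'a::real_algebra_1"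
  shows "(\<Sum>j<fst G. (if adj G i j then 1 else 0) * f j) = sum f (nbrs G i)"
proof -
  have "sum f (nbrs G i) = (\<Sum>j\<in>{j\<in>{..<fst G}. adj G i j}. f j)"
    by (rule sum.cong) (auto simp: nbrs_def verts_def adj_commute)
  also have "\<dots> = (\<Sum>j<fst G. if adj G i j then f j else 0)"
    by (rule sum.inter_filter) simp
  finally show ?thesis by (simp add: if_distrib[of "\<lambda>c. c * _"] cong: if_cong)
qed

lemma laplacian_index:
  "i < fst G \<Longrightarrow> j < fst G \<Longrightarrow>
    laplacian G $$ (i, j) = (if i = j then real (degree G i) else 0) - (if adj G i j then 1 else 0)"
  by (simp add: laplacian_def)

lemma laplacian_dim[simp]: "dim_row (laplacian G) = fst G" "dim_col (laplacian G) = fst G"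
  by (simp_all add: laplacian_def)

text \<open>Stated over a real algebra because it serves real trace computations as well as complex
  eigenvectors.\<close>

lemma laplacian_row_sum_of_real:
  fixes f :: "nat \<Rightarrow> 'a::real_algebra_1"
  assumes "i < fst G"
  shows "(\<Sum>j<fst G. of_real (laplacian G $$ (i, j)) * f j) = of_nat (degree G i) * f i - sum f (nbrs G i)"
proof -
  have "(\<Sum>j<fst G. of_real (laplacian G $$ (i, j)) * f j) =
    (\<Sum>j<fst G. (if i = j then of_nat (degree G i) * f j else 0) - (if adj G i j then 1 else 0) * f j)"
    by (rule sum.cong) (auto simp: laplacian_index assms left_diff_distrib)
  also have "\<dots> = of_nat (degree G i) * f i - sum f (nbrs G i)"
    using assms by (simp add: sum_subtractf sum_adj)
  finally show ?thesis .
qed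

lemma laplacian_row_sum:
  assumes "i < fst G"
  shows "(\<Sum>j<fst G. laplacian G $$ (i, j) * f j) = real (degree G i) * f i - sum f (nbrs G i)"
  using laplacian_row_sum_of_real[OF assms, of f] by simp

lemma laplacian_sym:
  "i < fst G \<Longrightarrow> j < fst G \<Longrightarrow> laplacian G $$ (i, j) = laplacian G $$ (j, i)"
  by (auto simp: laplacian_index adj_commute)

text \<open>Ordered triples: every triangle is counted six times, so the cardinality is the trace of
  the cube of the adjacency matrix.\<close>

definition triangles :: "graph \<Rightarrow> (nat \<times> nat \<times> nat) set" where
  "triangles G = {(i, j, k). adj G i j \<and> adj G j k \<and> adj G i k}"

lemma card_triangles:
  assumes "wf_graph G"
  shows "real (card (triangles G)) =
    (\<Sum>i<fst G. \<Sum>j\<in>nbrs G i. \<Sum>k\<in>nbrs G i. if adj G j k then 1 else 0)"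
proof -
  have "triangles G = (SIGMA i:{..<fst G}. SIGMA j:nbrs G i. {k \<in> nbrs G i. adj G j k})"
    using assms by (auto simp: triangles_def mem_nbrs adj_commute verts_def dest: adj_verts)
  then have "real (card (triangles G)) = (\<Sum>i<fst G. \<Sum>j\<in>nbrs G i. real (card {k \<in> nbrs G i. adj G j k}))"
    by (simp add: card_SigmaI)
  also have "\<dots> = (\<Sum>i<fst G. \<Sum>j\<in>nbrs G i. \<Sum>k\<in>nbrs G i. if adj G j k then 1 else 0)"
    by (simp flip: sum.inter_filter)
  finally show ?thesis .
qed

lemma sum_nbrs_swap:
  fixes f :: "nat \<Rightarrow> real"
  shows "(\<Sum>i<fst G. \<Sum>j\<in>nbrs G i. f j) = (\<Sum>j<fst G. real (degree G j) * f j)"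
proof -
  have "(\<Sum>i<fst G. \<Sum>j\<in>nbrs G i. f j) =
      (\<Sum>i<fst G. \<Sum>j<fst G. (if adj G i j then 1 else 0) * f j)"
    by (simp only: sum_adj)
  also have "\<dots> = (\<Sum>j<fst G. \<Sum>i<fst G. (if adj G i j then 1 else 0) * f j)"
    by (rule sum.swap)
  also have "\<dots> = (\<Sum>j<fst G. (\<Sum>i<fst G. (if adj G j i then 1 else 0) * 1) * f j)"
    unfolding sum_distrib_right by (intro sum.cong) (auto simp: adj_commute)
  also have "\<dots> = (\<Sum>j<fst G. real (degree G j) * f j)"
    unfolding sum_adj by (simp add: degree_eq_card_nbrs)
  finally show ?thesis .
qed

section \<open>Traces of the first three powers of the Laplacian\<close>

lemma trace_laplacian:
  assumes "wf_graph G"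
  shows "trace (laplacian G) = (\<Sum>i<fst G. real (degree G i))"
  by (auto simp: trace_def laplacian_index adj_irrefl[OF assms] laplacian_def intro!: sum.cong)

text \<open>Expansion of \<open>(D - A)^2\<close> as \<open>D L - A D + A^2\<close>; the last sum
  counts the common neighbours of \<open>i\<close> and \<open>j\<close>.\<close>

lemma laplacian_sq_index:
  assumes wf: "wf_graph G" and i: "i < fst G" and j: "j < fst G"
  shows "(laplacian G * laplacian G) $$ (i, j) =
    real (degree G i) * laplacian G $$ (i, j) - (if adj G i j then real (degree G j) else 0)
      + (\<Sum>k\<in>nbrs G i. if adj G j k then 1 else 0)"
proof -
  have "(laplacian G * laplacian G) $$ (i, j) = (\<Sum>k<fst G. laplacian G $$ (i, k) * laplacian G $$ (k, j))"
    by (rule mat_mult_index_sum) (use i j in auto)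
  also have "\<dots> = real (degree G i) * laplacian G $$ (i, j) - (\<Sum>k\<in>nbrs G i. laplacian G $$ (k, j))"
    by (rule laplacian_row_sum[OF i])
  also have "(\<Sum>k\<in>nbrs G i. laplacian G $$ (k, j)) =
      (\<Sum>k\<in>nbrs G i. (if k = j then real (degree G j) else 0) - (if adj G j k then 1 else 0))"
    using j by (intro sum.cong) (auto simp: laplacian_index nbrs_def verts_def adj_commute)
  also have "\<dots> = (if j \<in> nbrs G i then real (degree G j) else 0) - (\<Sum>k\<in>nbrs G i. if adj G j k then 1 else 0)"
    by (simp add: sum_subtractf)
  finally show ?thesis using wf by (auto simp: mem_nbrs adj_commute)
qed

lemma laplacian_sq_diag:
  assumes wf: "wf_graph G" and i: "i < fst G"
  shows "(laplacian G * laplacian G) $$ (i, i) = real (degree G i) ^ 2 + real (degree G i)"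
proof -
  have "(\<Sum>k\<in>nbrs G i. if adj G i k then 1 else 0 :: real) = (\<Sum>k\<in>nbrs G i. 1)"
    using wf by (intro sum.cong) (auto simp: mem_nbrs adj_commute)
  then show ?thesis
    unfolding laplacian_sq_index[OF wf i i]
    by (simp add: laplacian_index i adj_irrefl[OF wf] power2_eq_square degree_eq_card_nbrs)
qed

lemma trace_laplacian_sq:
  assumes wf: "wf_graph G"
  shows "trace (laplacian G * laplacian G) =
    (\<Sum>i<fst G. real (degree G i) ^ 2) + (\<Sum>i<fst G. real (degree G i))"
  unfolding trace_def sum.distrib[symmetric]
  by (rule sum.cong) (auto simp: laplacian_sq_diag[OF wf] simp del: index_mult_mat(1))

text \<open>In the trace of \<open>(D - A)^3\<close> the terms with a single \<open>A\<close> vanish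
  because \<open>A\<close> has zero diagonal, the terms with two give \<open>3 tr (D A^2)\<close>,
  which is three times the sum of squared degrees, and \<open>A^3\<close> counts the ordered
  triangles.\<close>

lemma trace_laplacian_cube:
  assumes wf: "wf_graph G"
  shows "trace (laplacian G * (laplacian G * laplacian G)) =
    (\<Sum>i<fst G. real (degree G i) ^ 3) + 3 * (\<Sum>i<fst G. real (degree G i) ^ 2) - real (card (triangles G))"
proof -
  let ?L = "laplacian G" and ?d = "\<lambda>i. real (degree G i)"
  have *: "(?L * (?L * ?L)) $$ (i, i) = ?d i ^ 3 + 2 * ?d i ^ 2 + (\<Sum>j\<in>nbrs G i. ?d j)
      - (\<Sum>j\<in>nbrs G i. \<Sum>k\<in>nbrs G i. if adj G j k then 1 else 0)"
    if i: "i < fst G" for i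
  proof -
    have "(?L * (?L * ?L)) $$ (i, i) = (\<Sum>j<fst G. ?L $$ (i, j) * (?L * ?L) $$ (j, i))"
      by (rule mat_mult_index_sum) (use i in auto)
    also have "\<dots> = ?d i * (?L * ?L) $$ (i, i) - (\<Sum>j\<in>nbrs G i. (?L * ?L) $$ (j, i))"
      by (rule laplacian_row_sum[OF i])
    also have "(\<Sum>j\<in>nbrs G i. (?L * ?L) $$ (j, i)) =
        (\<Sum>j\<in>nbrs G i. - ?d j - ?d i + (\<Sum>k\<in>nbrs G i. if adj G j k then 1 else 0))"
    proof (rule sum.cong[OF refl])
      fix j assume j: "j \<in> nbrs G i"
      then have jn: "j < fst G" and a: "adj G j i" by (auto simp: nbrs_def verts_def adj_commute)
      \<comment> \<open>The common neighbours of \<open>i\<close> and \<open>j\<close> may be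
        counted from either end.\<close>
      have "(\<Sum>k\<in>nbrs G j. if adj G i k then 1 else 0::real) = (\<Sum>k\<in>nbrs G i. if adj G j k then 1 else 0)"
        unfolding sum_adj[symmetric] by (intro sum.cong) auto
      moreover have "?L $$ (j, i) = - 1"
        using a adj_irrefl[OF wf] by (auto simp: laplacian_index i jn)
      ultimately show "(?L * ?L) $$ (j, i) = - ?d j - ?d i + (\<Sum>k\<in>nbrs G i. if adj G j k then 1 else 0)"
        unfolding laplacian_sq_index[OF wf jn i] using a by simp
    qed
    also have "\<dots> = - (\<Sum>j\<in>nbrs G i. ?d j) - ?d i * ?d i
        + (\<Sum>j\<in>nbrs G i. \<Sum>k\<in>nbrs G i. if adj G j k then 1 else 0)"
      by (simp add: sum.distrib sum_negf sum_subtractf degree_eq_card_nbrs)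
    finally show ?thesis
      unfolding laplacian_sq_diag[OF wf i]
      by (simp add: power2_eq_square power3_eq_cube algebra_simps)
  qed
  have "trace (?L * (?L * ?L)) = (\<Sum>i<fst G. ?d i ^ 3 + 2 * ?d i ^ 2 + (\<Sum>j\<in>nbrs G i. ?d j)
      - (\<Sum>j\<in>nbrs G i. \<Sum>k\<in>nbrs G i. if adj G j k then 1 else 0))"
    unfolding trace_def by (rule sum.cong) (auto simp: * simp del: index_mult_mat(1))
  also have "\<dots> = (\<Sum>i<fst G. ?d i ^ 3) + 2 * (\<Sum>i<fst G. ?d i ^ 2)
      + (\<Sum>i<fst G. ?d i * ?d i) - real (card (triangles G))"
    unfolding card_triangles[OF wf] sum_nbrs_swap[symmetric]
    by (simp add: sum.distrib sum_subtractf sum_distrib_left)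
  finally show ?thesis by (simp add: power2_eq_square)
qed

section \<open>Connectedness read off from the spectrum\<close>

definition connected_graph :: "graph \<Rightarrow> bool" where
  "connected_graph G \<longleftrightarrow> (\<forall>S. S \<subseteq> verts G \<and> S \<noteq> {} \<and> S \<noteq> verts G \<longrightarrow>
    (\<exists>u\<in>S. \<exists>v\<in>verts G - S. adj G u v))"

abbreviation ones_mat :: "nat \<Rightarrow> real mat" where
  "ones_mat n \<equiv> mat n n (\<lambda>_. 1)"

lemma char_poly_matrix_index:
  assumes "A \<in> carrier_mat n n" and "i < n" and "j < n"
  shows "char_poly_matrix A $$ (i, j) = (if i = j then [:0, 1:] else 0) - [:A $$ (i, j):]"
  using assms by (auto simp: char_poly_matrix_def)

lemma laplacian_row_sum_0: "i < fst G \<Longrightarrow> (\<Sum>j<fst G. laplacian G $$ (i, j)) = 0"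
  using laplacian_row_sum[of i G "\<lambda>_. 1"] by (simp add: degree_eq_card_nbrs)

text \<open>Since \<open>L J = 0\<close> for the all-ones matrix \<open>J\<close>, we have
  \<open>(x - L) (x - J) = x (x - (L + J))\<close>.\<close>

lemma char_poly_laplacian_add_ones:
  "char_poly (laplacian G) * char_poly (ones_mat (fst G)) =
    [:0, 1:] ^ fst G * char_poly (laplacian G + ones_mat (fst G))"
proof -
  let ?n = "fst G" let ?L = "laplacian G" let ?J = "ones_mat ?n"
  let ?X = "[:0, 1:] :: real poly"
  have L: "char_poly_matrix ?L \<in> carrier_mat ?n ?n" and J: "char_poly_matrix ?J \<in> carrier_mat ?n ?n"
    and LJ: "char_poly_matrix (?L + ?J) \<in> carrier_mat ?n ?n" by auto
  have "char_poly_matrix ?L * char_poly_matrix ?J = ?X \<cdot>\<^sub>m char_poly_matrix (?L + ?J)"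
  proof (rule eq_matI, unfold index_smult_mat)
    fix i j assume "i < dim_row (char_poly_matrix (?L + ?J))" "j < dim_col (char_poly_matrix (?L + ?J))"
    then have i: "i < ?n" and j: "j < ?n" by (simp_all only: carrier_matD[OF LJ])
    have "(char_poly_matrix ?L * char_poly_matrix ?J) $$ (i, j) =
      (\<Sum>k<?n. ((if i = k then ?X else 0) - [:?L $$ (i, k):]) * ((if k = j then ?X else 0) - [:1:]))"
      unfolding mat_mult_index_sum[OF L J i j]
      by (rule sum.cong) (auto simp: char_poly_matrix_index[OF laplacian_carrier]
          char_poly_matrix_index[where n = ?n] i j)
    also have "\<dots> = (\<Sum>k<?n. (if i = k then (if k = j then ?X * ?X else 0) - ?X else 0)
        - (if k = j then [:?L $$ (i, k):] * ?X else 0) + [:?L $$ (i, k):])"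
      by (rule sum.cong) (auto simp: algebra_simps)
    also have "\<dots> = (if i = j then ?X * ?X else 0) - ?X - [:?L $$ (i, j):] * ?X + (\<Sum>k<?n. [:?L $$ (i, k):])"
      using i j by (simp add: sum.distrib sum_subtractf)
    also have "(\<Sum>k<?n. [:?L $$ (i, k):]) = [:\<Sum>k<?n. ?L $$ (i, k):]"
      by (induction ?n) (auto simp: poly_eq_iff coeff_sum coeff_pCons split: nat.splits)
    finally have "(char_poly_matrix ?L * char_poly_matrix ?J) $$ (i, j) =
        (if i = j then ?X * ?X else 0) - ?X - [:?L $$ (i, j):] * ?X"
      by (simp add: laplacian_row_sum_0 i)
    moreover have "char_poly_matrix (?L + ?J) $$ (i, j) = (if i = j then ?X else 0) - [:?L $$ (i, j) + 1:]"
      using i j by (simp add: char_poly_matrix_index[where n = ?n])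
    ultimately show "(char_poly_matrix ?L * char_poly_matrix ?J) $$ (i, j) =
        ?X * char_poly_matrix (?L + ?J) $$ (i, j)"
      by (cases "i = j") simp_all
  qed (simp_all only: index_mult_mat carrier_matD[OF L] carrier_matD[OF J] carrier_matD[OF LJ])
  then have "det (char_poly_matrix ?L * char_poly_matrix ?J) = ?X ^ ?n * det (char_poly_matrix (?L + ?J))"
    by (simp only: det_smult carrier_matD[OF LJ])
  then show ?thesis unfolding char_poly_def det_mult[OF L J] .
qed

lemma laplacian_add_ones_mult_vec:
  assumes "v \<in> carrier_vec (fst G)" and "i < fst G"
  shows "((laplacian G + ones_mat (fst G)) *\<^sub>v v) $ i =
    real (degree G i) * v $ i - (\<Sum>j\<in>nbrs G i. v $ j) + (\<Sum>j<fst G. v $ j)"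
proof -
  have "((laplacian G + ones_mat (fst G)) *\<^sub>v v) $ i =
      (\<Sum>j<fst G. laplacian G $$ (i, j) * v $ j + v $ j)"
    using assms by (auto simp: scalar_prod_def atLeast0LessThan algebra_simps intro!: sum.cong)
  then show ?thesis
    using laplacian_row_sum[OF assms(2), of "\<lambda>j. v $ j"] by (simp add: sum.distrib)
qed

text \<open>Adding the all-ones matrix moves the all-ones vector from eigenvalue 0 to
  \<open>n\<close>, so what is left at 0 are the null vectors of \<open>L\<close> with coordinate
  sum 0. On a connected graph the maximum principle makes such a vector constant, hence zero; an
  uncrossed cut provides a nonzero one. Describing connectedness by cuts lets the maximal level set
  be used directly.\<close>

lemma connected_iff_char_poly:
  assumes wf: "wf_graph G"
  shows "connected_graph G \<longleftrightarrow> poly (char_poly (laplacian G + ones_mat (fst G))) 0 \<noteq> 0"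
proof -
  let ?n = "fst G" let ?M = "laplacian G + ones_mat ?n"
  have M: "?M \<in> carrier_mat ?n ?n" by simp
  have "eigenvalue ?M 0 \<longleftrightarrow> \<not> connected_graph G"
  proof
    assume "eigenvalue ?M 0"
    then obtain v where v: "v \<in> carrier_vec ?n" "v \<noteq> 0\<^sub>v ?n" "?M *\<^sub>v v = 0 \<cdot>\<^sub>v v"
      unfolding eigenvalue_def eigenvector_def using M by auto
    have eq: "real (degree G i) * v $ i - (\<Sum>j\<in>nbrs G i. v $ j) + (\<Sum>j<?n. v $ j) = 0" if "i < ?n" for i
      using laplacian_add_ones_mult_vec[OF v(1) that] v(1,3) that by simp
    \<comment> \<open>Summing all rows of the null equation cancels the Laplacian part and leaves
      \<open>n\<close> times the coordinate sum.\<close>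
    have "0 = (\<Sum>i<?n. real (degree G i) * v $ i - (\<Sum>j\<in>nbrs G i. v $ j) + (\<Sum>j<?n. v $ j))"
      by (simp add: eq)
    also have "\<dots> = real ?n * (\<Sum>j<?n. v $ j)"
      by (simp add: sum.distrib sum_subtractf sum_nbrs_swap)
    finally have s0: "(\<Sum>j<?n. v $ j) = 0" by auto
    from v(1,2) obtain i0 where i0: "i0 < ?n" "v $ i0 \<noteq> 0" by (auto simp: vec_eq_iff)
    define m where "m = Max ((\<lambda>i. v $ i) ` {..<?n})"
    have mle: "v $ i \<le> m" if "i < ?n" for i
      unfolding m_def using that by auto
    have "m \<in> (\<lambda>i. v $ i) ` {..<?n}"
      unfolding m_def using i0 by (intro Max_in) auto
    then obtain i1 where i1: "i1 < ?n" "v $ i1 = m" by auto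
    \<comment> \<open>At a vertex where the maximum is attained the value is the average over the
      neighbours, so all neighbours attain it too.\<close>
    define S where "S = {i. i < ?n \<and> v $ i = m}"
    have cl: "w \<in> S" if "u \<in> S" "adj G u w" for u w
    proof -
      from that have u: "u < ?n" "v $ u = m" by (auto simp: S_def)
      have "real (card (nbrs G u)) * m - (\<Sum>j\<in>nbrs G u. v $ j) = 0"
        using eq[OF u(1)] u(2) s0 by (simp add: degree_eq_card_nbrs)
      then have "(\<Sum>j\<in>nbrs G u. m - v $ j) = 0" by (simp add: sum_subtractf)
      moreover have "\<forall>j\<in>nbrs G u. 0 \<le> m - v $ j" using mle by (auto simp: nbrs_def verts_def)
      ultimately have "\<forall>j\<in>nbrs G u. m - v $ j = 0" by (simp add: sum_nonneg_eq_0_iff)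
      moreover have "w \<in> nbrs G u" using that wf by (simp add: mem_nbrs adj_commute)
      ultimately show ?thesis by (auto simp: S_def nbrs_def verts_def)
    qed
    have "S \<noteq> verts G"
    proof
      assume "S = verts G"
      have c: "v $ i = m" if "i < ?n" for i
      proof -
        have "i \<in> S" unfolding \<open>S = verts G\<close> using that by (simp add: verts_def)
        then show ?thesis by (simp add: S_def)
      qed
      then have "(\<Sum>j<?n. v $ j) = real ?n * m" by simp
      then have "m = 0" using s0 i0(1) by simp
      with i0(2) c[OF i0(1)] show False by simp
    qed
    moreover have "S \<subseteq> verts G" "S \<noteq> {}" using i1 by (auto simp: S_def verts_def)
    ultimately show "\<not> connected_graph G" unfolding connected_graph_def using cl by blast
  next
    assume "\<not> connected_graph G"
    then obtain S where S: "S \<subseteq> verts G" "S \<noteq> {}" "S \<noteq> verts G"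
      and no': "\<forall>u\<in>S. \<forall>v\<in>verts G - S. \<not> adj G u v"
      unfolding connected_graph_def by metis
    note no = no'[rule_format]
    let ?T = "verts G - S"
    have fS: "finite S" using finite_subset[OF S(1)] by simp
    \<comment> \<open>Constant on each side of the uncrossed cut, hence annihilated by
      \<open>L\<close>; the two weights are chosen to make the coordinate sum 0.\<close>
    define v where "v = vec ?n (\<lambda>i. if i \<in> S then real (card ?T) else - real (card S))"
    have vc: "v \<in> carrier_vec ?n" by (simp add: v_def)
    have sS: "(\<Sum>j<?n. v $ j) = 0"
    proof -
      have "(\<Sum>j<?n. v $ j) = (\<Sum>j\<in>verts G. if j \<in> S then real (card ?T) else - real (card S))"
        by (rule sum.cong) (auto simp: verts_def v_def)
      also have "\<dots> = (\<Sum>j\<in>S. if j \<in> S then real (card ?T) else - real (card S)) +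
          (\<Sum>j\<in>?T. if j \<in> S then real (card ?T) else - real (card S))"
        using sum.subset_diff[OF S(1) finite_verts] by (simp only: add.commute)
      also have "\<dots> = 0" by simp
      finally show ?thesis .
    qed
    have "(?M *\<^sub>v v) $ i = 0" if i: "i < ?n" for i
    proof -
      have "(\<Sum>j\<in>nbrs G i. v $ j) = (\<Sum>j\<in>nbrs G i. v $ i)"
      proof (rule sum.cong[OF refl])
        fix j assume "j \<in> nbrs G i"
        then have "j < ?n" "adj G i j" "adj G j i" by (auto simp: nbrs_def verts_def adj_commute)
        with no[of i j] no[of j i] i show "v $ j = v $ i" by (auto simp: v_def verts_def)
      qed
      then show ?thesis
        unfolding laplacian_add_ones_mult_vec[OF vc i] by (simp add: sS degree_eq_card_nbrs)
    qed
    then have "?M *\<^sub>v v = 0 \<cdot>\<^sub>v v" using vc by (intro eq_vecI) auto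
    moreover have "v \<noteq> 0\<^sub>v ?n"
    proof
      assume z: "v = 0\<^sub>v ?n"
      from S obtain s where "s \<in> S" by blast
      then have s: "s \<in> S" "s < ?n" using S(1) by (auto simp: verts_def)
      have "v $ s = 0" using z s by simp
      then have "card ?T = 0" using s by (simp add: v_def)
      then have "?T = {}" by simp
      with S(1,3) show False by blast
    qed
    ultimately show "eigenvalue ?M 0"
      unfolding eigenvalue_def eigenvector_def using M vc by auto
  qed
  then show ?thesis using eigenvalue_root_char_poly[OF M, of 0] by auto
qed

text \<open>The other two factors in \<open>char_poly_laplacian_add_ones\<close> depend only on the
  number of vertices, so the spectrum of \<open>L\<close> determines that of
  \<open>L + J\<close>.\<close>

lemma connected_graph_cospectral:
  assumes "wf_graph G" and "wf_graph H" and co: "L_cospectral H G" and "connected_graph G"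
  shows "connected_graph H"
proof -
  have "char_poly (laplacian G + ones_mat (fst G)) = char_poly (laplacian H + ones_mat (fst H))"
    using char_poly_laplacian_add_ones[of G] char_poly_laplacian_add_ones[of H]
      L_cospectral_char_poly[OF co] L_cospectral_order[OF co] by simp
  then show ?thesis using assms connected_iff_char_poly by metis
qed

section \<open>Degrees and the largest eigenvalue\<close>

lemma pow_mat_add:
  assumes "A \<in> carrier_mat n n"
  shows "A ^\<^sub>m (k + l) = A ^\<^sub>m k * A ^\<^sub>m l"
proof (induction l)
  case 0
  then show ?case using assms by simp
next
  case (Suc l)
  then show ?case
    using assoc_mult_mat[of "A ^\<^sub>m k" n n "A ^\<^sub>m l" n A n] assms by simp
qed

lemma pow_mat_sym:
  fixes A :: "'a::comm_semiring_1 mat"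
  assumes A: "A \<in> carrier_mat n n" and sym: "\<And>i j. i < n \<Longrightarrow> j < n \<Longrightarrow> A $$ (i, j) = A $$ (j, i)"
    and "i < n" and "j < n"
  shows "(A ^\<^sub>m k) $$ (i, j) = (A ^\<^sub>m k) $$ (j, i)"
  using assms(3,4)
proof (induction k arbitrary: i j)
  case 0
  then show ?case using A by auto
next
  case (Suc k)
  have Ak: "A ^\<^sub>m k \<in> carrier_mat n n" using A by simp
  have comm: "A ^\<^sub>m k * A = A * A ^\<^sub>m k"
    using pow_mat_add[OF A, of k 1] pow_mat_add[OF A, of 1 k] A by (simp add: add.commute)
  have "(A ^\<^sub>m Suc k) $$ (i, j) = (\<Sum>l<n. (A ^\<^sub>m k) $$ (i, l) * A $$ (l, j))"
    using mat_mult_index_sum[OF Ak A] Suc.prems by simp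
  also have "\<dots> = (\<Sum>l<n. A $$ (j, l) * (A ^\<^sub>m k) $$ (l, i))"
    using Suc sym by (intro sum.cong) (auto simp: mult.commute)
  also have "\<dots> = (A * A ^\<^sub>m k) $$ (j, i)"
    using mat_mult_index_sum[OF A Ak] Suc.prems by simp
  also have "\<dots> = (A ^\<^sub>m Suc k) $$ (j, i)"
    by (simp flip: comm)
  finally show ?case .
qed

text \<open>The spectral theorem is avoided: \<open>|A\<^sup>k x|\<^sup>2 \<le> tr (A\<^bsup>2k\<^esup>) |x|\<^sup>2\<close> bounds the growth of
  \<open>|A\<^sup>k x|\<close> along \<open>k = 2\<^sup>j\<close> from above, and \<open>|A\<^sup>k x|\<^sup>2 \<le> |x| |A\<^bsup>2k\<^esup> x|\<close> bounds it from below.\<close>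

lemma symmetric_quadratic_form_le:
  fixes A :: "real mat" and x :: "nat \<Rightarrow> real"
  assumes A: "A \<in> carrier_mat n n" and sym: "\<And>i j. i < n \<Longrightarrow> j < n \<Longrightarrow> A $$ (i, j) = A $$ (j, i)"
    and ev: "\<And>l. eigenvalue (map_mat complex_of_real A) l \<Longrightarrow> cmod l \<le> r" and r: "r \<ge> 0"
  shows "(\<Sum>i<n. x i * (\<Sum>j<n. A $$ (i, j) * x j)) \<le> r * (\<Sum>i<n. (x i)\<^sup>2)"
proof (rule ccontr)
  assume "\<not> ?thesis"
  then have gt: "(\<Sum>i<n. x i * (\<Sum>j<n. A $$ (i, j) * x j)) > r * (\<Sum>i<n. (x i)\<^sup>2)" by simp
  define N where "N = (\<Sum>i<n. (x i)\<^sup>2)"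
  have N0: "N > 0"
  proof -
    have "N \<noteq> 0"
    proof
      assume "N = 0"
      then have "\<forall>i<n. x i = 0" by (auto simp: N_def sum_nonneg_eq_0_iff)
      with gt show False by simp
    qed
    then show ?thesis unfolding N_def by (metis sum_nonneg zero_le_power2 less_eq_real_def)
  qed
  define w where "w k i = (\<Sum>j<n. (A ^\<^sub>m k) $$ (i, j) * x j)" for k i
  define a where "a k = (\<Sum>i<n. (w k i)\<^sup>2)" for k
  have Ak: "A ^\<^sub>m k \<in> carrier_mat n n" for k using A by simp
  have sq: "(A ^\<^sub>m (2 * k)) $$ (i, j) = (\<Sum>l<n. (A ^\<^sub>m k) $$ (l, i) * (A ^\<^sub>m k) $$ (l, j))"
    if "i < n" "j < n" for i j k
  proof -
    have "A ^\<^sub>m (2 * k) = A ^\<^sub>m k * A ^\<^sub>m k" using pow_mat_add[OF A] by (simp add: mult_2)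
    then show ?thesis
      unfolding mat_mult_index_sum[OF Ak Ak that] 
      using mat_mult_index_sum[OF Ak Ak that] pow_mat_sym[OF A sym] that by simp
  qed
  have a_eq: "a k = (\<Sum>i<n. x i * w (2 * k) i)" for k
  proof -
    have "a k = (\<Sum>l<n. \<Sum>i<n. \<Sum>j<n. x i * ((A ^\<^sub>m k) $$ (l, i) * (A ^\<^sub>m k) $$ (l, j) * x j))"
      unfolding a_def w_def power2_eq_square sum_product by (intro sum.cong) (auto simp: ac_simps)
    also have "\<dots> = (\<Sum>i<n. \<Sum>l<n. \<Sum>j<n. x i * ((A ^\<^sub>m k) $$ (l, i) * (A ^\<^sub>m k) $$ (l, j) * x j))"
      by (rule sum.swap)
    also have "\<dots> = (\<Sum>i<n. \<Sum>j<n. \<Sum>l<n. x i * ((A ^\<^sub>m k) $$ (l, i) * (A ^\<^sub>m k) $$ (l, j) * x j))"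
      by (rule sum.cong[OF refl], rule sum.swap)
    also have "\<dots> = (\<Sum>i<n. x i * w (2 * k) i)"
      unfolding w_def sum_distrib_left by (intro sum.cong) (auto simp: sq sum_distrib_left sum_distrib_right)
    finally show ?thesis .
  qed
  have dbl: "(a k)\<^sup>2 \<le> N * a (2 * k)" for k
    unfolding a_eq[of k] N_def a_def[of "2 * k"] by (rule Cauchy_Schwarz_ineq_sum)
  have upper: "a k \<le> real n * r ^ (2 * k) * N" for k
  proof -
    \<comment> \<open>Cauchy-Schwarz in each row bounds \<open>a k\<close> by the squared Frobenius
      norm of the power, which for a symmetric matrix is the trace of its square.\<close>
    have "a k \<le> (\<Sum>i<n. (\<Sum>j<n. ((A ^\<^sub>m k) $$ (i, j))\<^sup>2) * N)"
      unfolding a_def w_def N_def by (intro sum_mono Cauchy_Schwarz_ineq_sum)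
    also have "\<dots> = (\<Sum>i<n. \<Sum>j<n. ((A ^\<^sub>m k) $$ (i, j))\<^sup>2) * N"
      by (simp add: sum_distrib_right)
    also have "(\<Sum>i<n. \<Sum>j<n. ((A ^\<^sub>m k) $$ (i, j))\<^sup>2) = trace (A ^\<^sub>m (2 * k))"
    proof -
      have "trace (A ^\<^sub>m (2 * k)) = (\<Sum>j<n. \<Sum>i<n. ((A ^\<^sub>m k) $$ (i, j))\<^sup>2)"
        unfolding trace_def using Ak[of "2 * k"] by (auto simp: sq power2_eq_square)
      then show ?thesis by (subst sum.swap) simp
    qed
    also have "trace (A ^\<^sub>m (2 * k)) * N \<le> (real n * r ^ (2 * k)) * N"
      using trace_pow_bound[OF A ev, of "2 * k"] N0 by (intro mult_right_mono) auto
    finally show ?thesis .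
  qed
  \<comment> \<open>The Rayleigh quotient of \<open>x\<close>, which exceeds \<open>r\<close> by the
    negated claim. It remains to play \<open>s ^ (2 * k)\<close> against
    \<open>n * r ^ (2 * k)\<close> for large \<open>k\<close>.\<close>
  define s where "s = (\<Sum>i<n. x i * w 1 i) / N"
  have s: "s > r" using gt N0 A by (simp add: s_def w_def N_def field_simps)
  have lower: "s ^ (2 * 2 ^ j) * N \<le> a (2 ^ j)" for j
  proof (induction j)
    case 0
    have "(\<Sum>i<n. x i * w 1 i)\<^sup>2 \<le> N * a 1"
      unfolding N_def a_def by (rule Cauchy_Schwarz_ineq_sum)
    then show ?case using N0 by (simp add: s_def power_divide power2_eq_square field_simps)
  next
    case (Suc j)
    have "(s ^ (2 * 2 ^ j) * N)\<^sup>2 \<le> (a (2 ^ j))\<^sup>2"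
      using Suc s r N0 by (intro power_mono) auto
    also have "\<dots> \<le> N * a (2 * 2 ^ j)" by (rule dbl)
    finally have "N * (s ^ (2 * 2 ^ Suc j) * N) \<le> N * a (2 ^ Suc j)"
      by (simp add: power_mult_distrib power2_eq_square power_add[symmetric] ac_simps)
    then show ?case using N0 by simp
  qed
  have both: "s ^ (2 * 2 ^ j) \<le> real n * r ^ (2 * 2 ^ j)" for j
    using order_trans[OF lower upper, of j] N0 by simp
  have r0: "r > 0"
  proof (rule ccontr)
    assume "\<not> r > 0"
    with r have "r = 0" by simp
    with both[of 0] s show False by (simp add: power2_eq_square) (metis mult_pos_pos not_le)
  qed
  \<comment> \<open>The geometric growth of \<open>(s / r) ^ (2 * k)\<close> eventually beats the
    constant factor \<open>n\<close>.\<close>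
  have "s / r > 1" using s r0 by simp
  from real_arch_pow[OF this, of "real n"] obtain m where m: "real n < (s / r) ^ m" by auto
  have "m \<le> 2 * 2 ^ m" using less_exp[of m] by linarith
  then have "(s / r) ^ m \<le> (s / r) ^ (2 * 2 ^ m)" using \<open>s / r > 1\<close> by (intro power_increasing) auto
  with m have "real n < (s / r) ^ (2 * 2 ^ m)" by linarith
  with both[of m] r0 show False by (simp add: power_divide field_simps)
qed

text \<open>The test vector \<open>x\<close> is the eigenvector of the star at \<open>v\<close> for
  its largest Laplacian eigenvalue \<open>D + 1\<close>. Further edges of the graph can only
  increase the quadratic form, so the Rayleigh quotient of \<open>x\<close> is at least
  \<open>D + 1\<close>.\<close>

lemma degree_Suc_le_spectral_bound:
  assumes wf: "wf_graph G" and v: "v \<in> verts G" and d: "degree G v > 0"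
    and ev: "\<And>l. eigenvalue (map_mat complex_of_real (laplacian G)) l \<Longrightarrow> cmod l \<le> r" and r: "r \<ge> 0"
  shows "real (degree G v) + 1 \<le> r"
proof -
  let ?n = "fst G" and ?N = "nbrs G v"
  define D where "D = real (degree G v)"
  define x where "x i = (if i = v then D else if i \<in> ?N then -1 else 0)" for i
  have vN: "v \<notin> ?N" using adj_irrefl[OF wf] by (simp add: nbrs_def)
  have sub: "insert v ?N \<subseteq> {..<?n}" using v by (auto simp: nbrs_def verts_def)
  have outside: "x i = 0" if "i \<notin> insert v ?N" for i using that by (simp add: x_def)
  have restrict: "(\<Sum>i<?n. g i) = g v + (\<Sum>u\<in>?N. g u)"
    if "\<And>i. i \<notin> insert v ?N \<Longrightarrow> g i = 0" for g :: "nat \<Rightarrow> real"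
  proof -
    have "(\<Sum>i<?n. g i) = (\<Sum>i\<in>insert v ?N. g i)"
      by (rule sum.mono_neutral_right) (use sub that in auto)
    then show ?thesis using vN by simp
  qed
  have norm: "(\<Sum>i<?n. (x i)\<^sup>2) = D\<^sup>2 + D"
  proof -
    have "(\<Sum>u\<in>?N. (x u)\<^sup>2) = (\<Sum>u\<in>?N. 1)" using vN by (intro sum.cong) (auto simp: x_def)
    then show ?thesis
      by (subst restrict) (auto simp: outside x_def D_def degree_eq_card_nbrs)
  qed
  define y where "y i = real (degree G i) * x i - sum x (nbrs G i)" for i
  have "sum x ?N = (\<Sum>u\<in>?N. -1)" using vN by (intro sum.cong) (auto simp: x_def)
  then have yv: "y v = D * D + D" by (simp add: y_def x_def D_def degree_eq_card_nbrs)
  \<comment> \<open>The neighbour \<open>v\<close> contributes \<open>D\<close>; each other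
    neighbour of \<open>u\<close> contributes at least -1, and together they use up all but one unit
    of the degree of \<open>u\<close>.\<close>
  have yu: "- y u \<ge> D + 1" if u: "u \<in> ?N" for u
  proof -
    have vu: "v \<in> nbrs G u" using u wf by (simp add: mem_nbrs adj_commute)
    have "sum x (nbrs G u) = x v + sum x (nbrs G u - {v})"
      by (rule sum.remove[OF finite_nbrs vu])
    moreover have "sum x (nbrs G u - {v}) \<ge> (\<Sum>j\<in>nbrs G u - {v}. -1)"
      by (rule sum_mono) (auto simp: x_def)
    moreover have "real (degree G u) \<ge> 1"
      using vu by (simp add: degree_eq_card_nbrs) (metis card_gt_0_iff empty_iff finite_nbrs Suc_leI One_nat_def)
    moreover have "(\<Sum>j\<in>nbrs G u - {v}. -1 :: real) = 1 - real (degree G u)"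
      using vu calculation(3) by (simp add: degree_eq_card_nbrs of_nat_diff)
    moreover have "x u = -1" "x v = D" using u vN by (auto simp: x_def)
    ultimately show ?thesis by (simp add: y_def)
  qed
  have "(\<Sum>i<?n. x i * (\<Sum>j<?n. laplacian G $$ (i, j) * x j)) = (\<Sum>i<?n. x i * y i)"
    by (rule sum.cong) (auto simp: laplacian_row_sum y_def)
  also have "\<dots> = x v * y v + (\<Sum>u\<in>?N. x u * y u)"
    by (rule restrict) (simp add: outside)
  also have "\<dots> \<ge> D * (D * D + D) + (\<Sum>u\<in>?N. D + 1)"
  proof -
    have "(\<Sum>u\<in>?N. x u * y u) \<ge> (\<Sum>u\<in>?N. D + 1)"
      using yu vN by (intro sum_mono) (auto simp: x_def)
    then show ?thesis using yv by (simp add: x_def)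
  qed
  also have "D * (D * D + D) + (\<Sum>u\<in>?N. D + 1) = (D + 1) * (D\<^sup>2 + D)"
    by (simp add: D_def degree_eq_card_nbrs power2_eq_square algebra_simps)
  finally have "(D + 1) * (D\<^sup>2 + D) \<le> (\<Sum>i<?n. x i * (\<Sum>j<?n. laplacian G $$ (i, j) * x j))" .
  also have "\<dots> \<le> r * (\<Sum>i<?n. (x i)\<^sup>2)"
    by (rule symmetric_quadratic_form_le[OF laplacian_carrier laplacian_sym ev r])
  finally have "(D + 1) * (D\<^sup>2 + D) \<le> r * (D\<^sup>2 + D)" unfolding norm .
  moreover have "D\<^sup>2 + D > 0" using d by (simp add: D_def add_pos_pos)
  ultimately show ?thesis unfolding D_def by simp
qed

section \<open>The jellyfish graph\<close>

lemma fst_jfg[simp]: "fst (jfg p q) = q + q * p"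
  by (simp add: jfg_def)

lemma pendant_index_less: "i < q \<Longrightarrow> j < p \<Longrightarrow> q + i * p + j < q + q * (p::nat)"
proof -
  assume a: "i < q" "j < p"
  have "i * p + j < Suc i * p" using a by simp
  also have "\<dots> \<le> q * p" using a by (intro mult_right_mono) auto
  finally show ?thesis by simp
qed

lemma pendant_index_inj:
  fixes i i' j j' p :: nat
  assumes "j < p" and "j' < p"
  shows "q + i * p + j = q + i' * p + j' \<longleftrightarrow> i = i' \<and> j = j'"
proof
  assume "q + i * p + j = q + i' * p + j'"
  then have e: "i * p + j = i' * p + j'" by simp
  from arg_cong[OF e, of "\<lambda>k. k div p"] assms have "i = i'" by simp
  with e show "i = i' \<and> j = j'" by simp
qed simp

lemma verts_jfg_cases:
  assumes "k \<in> verts (jfg p q)"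
  obtains "k < q" | i j where "i < q" "j < p" "k = q + i * p + j"
proof (cases "k < q")
  case False
  with assms have k: "k - q < q * p" "q + (k - q) = k" by (auto simp: verts_def)
  then have "p > 0" by (cases p) auto
  have "(k - q) div p < q" using k(1) by (simp add: less_mult_imp_div_less)
  moreover have "(k - q) mod p < p" using \<open>p > 0\<close> by simp
  moreover have "k = q + (k - q) div p * p + (k - q) mod p" using k(2) by simp
  ultimately show ?thesis using that(2) by blast
qed (use that in auto)

abbreviation cyc_succ :: "nat \<Rightarrow> nat \<Rightarrow> nat" where
  "cyc_succ q i \<equiv> (i + 1) mod q"

lemma adj_jfg:
  "adj (jfg p q) u v \<longleftrightarrow>
    (u < q \<and> v = cyc_succ q u) \<or> (v < q \<and> u = cyc_succ q v) \<or>
    (u < q \<and> (\<exists>j<p. v = q + u * p + j)) \<or> (v < q \<and> (\<exists>j<p. u = q + v * p + j))"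
  unfolding adj_def edges_def jfg_def by (auto simp: doubleton_eq_iff)

lemma wf_jfg:
  assumes "q \<ge> 2"
  shows "wf_graph (jfg p q)"
proof -
  have "{i, cyc_succ q i} \<subseteq> {0..<q + q * p} \<and> card {i, cyc_succ q i} = 2" if "i < q" for i
  proof -
    have "i \<noteq> cyc_succ q i" using that assms by (cases "i + 1 = q") auto
    moreover have "cyc_succ q i < q" using that by simp
    ultimately show ?thesis using that by (auto simp: card_insert_if intro: trans_less_add1)
  qed
  moreover have "{i, q + i * p + j} \<subseteq> {0..<q + q * p} \<and> card {i, q + i * p + j} = 2" if "i < q" "j < p" for i j
    using that pendant_index_less[OF that] by (auto simp: card_insert_if)
  ultimately show ?thesis
    unfolding wf_graph_def verts_def edges_def by (fastforce simp: jfg_def)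
qed

lemma cyc_succ_eq_iff:
  assumes "u < q" "v < q"
  shows "u = cyc_succ q v \<longleftrightarrow> v = (if u = 0 then q - 1 else u - 1)"
  using assms by (cases "v + 1 = q") (auto split: if_splits)

lemma nbrs_jfg_cycle:
  assumes "i < q"
  shows "nbrs (jfg p q) i = {cyc_succ q i, if i = 0 then q - 1 else i - 1} \<union> (\<lambda>j. q + i * p + j) ` {..<p}"
proof -
  have "adj (jfg p q) i v \<longleftrightarrow> v = cyc_succ q i \<or> v = (if i = 0 then q - 1 else i - 1) \<or> (\<exists>j<p. v = q + i * p + j)" for v
  proof -
    have "(v < q \<and> i = cyc_succ q v) \<longleftrightarrow> v = (if i = 0 then q - 1 else i - 1)"
      using cyc_succ_eq_iff[OF assms, of v] assms by (auto split: if_splits)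
    moreover have "\<not> (v < q \<and> (\<exists>j<p. i = q + v * p + j))" using assms by auto
    ultimately show ?thesis unfolding adj_jfg using assms by blast
  qed
  moreover have "v < q + q * p" if "v = cyc_succ q i \<or> v = (if i = 0 then q - 1 else i - 1) \<or> (\<exists>j<p. v = q + i * p + j)" for v
  proof -
    have "cyc_succ q i < q + q * p" using assms by (simp add: trans_less_add1)
    then show ?thesis using that pendant_index_less[OF assms] assms by (auto split: if_splits)
  qed
  ultimately have "v \<in> nbrs (jfg p q) i \<longleftrightarrow>
      v = cyc_succ q i \<or> v = (if i = 0 then q - 1 else i - 1) \<or> (\<exists>j<p. v = q + i * p + j)" for v
    unfolding nbrs_def verts_def mem_Collect_eq atLeastLessThan_iff fst_jfg by blast
  then show ?thesis by blast
qed

lemma nbrs_jfg_pendant: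
  assumes "i < q" and "j < p"
  shows "nbrs (jfg p q) (q + i * p + j) = {i}"
proof -
  have lt: "q + i * p + j \<noteq> cyc_succ q v" if "v < q" for v
    using mod_less_divisor[of q "v + 1"] that by linarith
  have "adj (jfg p q) (q + i * p + j) v \<longleftrightarrow> v = i" for v
    unfolding adj_jfg using assms lt pendant_index_inj[OF assms(2), where i = i and i' = v] by auto
  then show ?thesis using assms by (auto simp: nbrs_def verts_def)
qed

lemma cycle_pendant_disjoint:
  assumes "i < q"
  shows "{cyc_succ q i, if i = 0 then q - 1 else i - 1} \<inter> (\<lambda>j. q + i * p + j) ` {..<p} = {}"
    (is "?A \<inter> ?B = {}")
proof -
  have "cyc_succ q i < q" "(if i = 0 then q - 1 else i - 1) < q"
    using assms by (auto intro: mod_less_divisor)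
  then have "?A \<subseteq> {..<q}" by simp
  then have "?A \<inter> ?B \<subseteq> {..<q} \<inter> {q..}" by (intro Int_mono) auto
  then show ?thesis by auto
qed

lemma degree_jfg_cycle:
  assumes "i < q" and "q \<ge> 3"
  shows "degree (jfg p q) i = p + 2"
proof -
  let ?A = "{cyc_succ q i, if i = 0 then q - 1 else i - 1}" and ?B = "(\<lambda>j. q + i * p + j) ` {..<p}"
  have "cyc_succ q i \<noteq> (if i = 0 then q - 1 else i - 1)"
    using assms by (cases "i + 1 = q") auto
  then have "card ?A = 2" by simp
  moreover have "card ?B = p" by (simp add: card_image inj_on_def)
  moreover have "?A \<inter> ?B = {}" by (rule cycle_pendant_disjoint[OF assms(1)])
  ultimately have "card (?A \<union> ?B) = p + 2" by (subst card_Un_disjoint) auto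
  then show ?thesis unfolding degree_eq_card_nbrs nbrs_jfg_cycle[OF assms(1)] .
qed

lemma degree_jfg_pendant: "i < q \<Longrightarrow> j < p \<Longrightarrow> degree (jfg p q) (q + i * p + j) = 1"
  by (simp add: degree_eq_card_nbrs nbrs_jfg_pendant)

lemma sum_degree_jfg:
  fixes f :: "nat \<Rightarrow> real"
  assumes "q \<ge> 3"
  shows "(\<Sum>i<q + q * p. f (degree (jfg p q) i)) = real q * f (p + 2) + real (q * p) * f 1"
proof -
  have "(\<Sum>i<q + q * p. f (degree (jfg p q) i)) =
    (\<Sum>i<q. f (degree (jfg p q) i)) + (\<Sum>i\<in>{q..<q + q * p}. f (degree (jfg p q) i))"
    by (subst sum.union_disjoint[symmetric]) (auto intro!: sum.cong)
  also have "(\<Sum>i<q. f (degree (jfg p q) i)) = (\<Sum>i<q. f (p + 2))"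
    using assms by (intro sum.cong) (auto simp: degree_jfg_cycle)
  also have "(\<Sum>i\<in>{q..<q + q * p}. f (degree (jfg p q) i)) = (\<Sum>i\<in>{q..<q + q * p}. f 1)"
  proof (rule sum.cong[OF refl])
    fix k assume k: "k \<in> {q..<q + q * p}"
    then have "k \<in> verts (jfg p q)" by (simp add: verts_def)
    then show "f (degree (jfg p q) k) = f 1"
      by (cases rule: verts_jfg_cases) (use k in \<open>auto simp: degree_jfg_pendant[simplified]\<close>)
  qed
  finally show ?thesis by simp
qed

text \<open>A pendant vertex has only one neighbour, so a triangle would lie on the cycle. There
  three steps of size 1 in either direction would have to add up to a multiple of \<open>q\<close>,
  which is impossible for \<open>q \<ge> 4\<close>.\<close>

lemma triangles_jfg:
  assumes "q \<ge> 4"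
  shows "triangles (jfg p q) = {}"
proof -
  have wf: "wf_graph (jfg p q)" using wf_jfg assms by simp
  have pend: False if a: "adj (jfg p q) a b" "adj (jfg p q) a c" "adj (jfg p q) b c" "\<not> a < q" for a b c
  proof -
    have "a \<in> verts (jfg p q)" using adj_verts[OF wf a(1)] by simp
    then obtain i j where "i < q" "j < p" "a = q + i * p + j"
      using a(4) by (cases rule: verts_jfg_cases) auto
    then have "b = i" "c = i" using nbrs_jfg_pendant a(1,2) by (auto simp flip: mem_nbrs[OF wf])
    then show False using a(3) adj_irrefl[OF wf] by simp
  qed
  have cyc: "v = cyc_succ q u \<or> u = cyc_succ q v" if "adj (jfg p q) u v" "u < q" "v < q" for u v
    using that unfolding adj_jfg by auto
  have False if a: "adj (jfg p q) a b" "adj (jfg p q) b c" "adj (jfg p q) a c" for a b c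
  proof -
    have lt: "a < q" "b < q" "c < q"
      using pend[of a b c] pend[of b a c] pend[of c a b] a adj_commute by blast+
    have step: "v + 1 = u \<or> u + 1 = v \<or> u = 0 \<and> v + 1 = q \<or> v = 0 \<and> u + 1 = q"
      if "adj (jfg p q) u v" "u < q" "v < q" for u v
      using cyc[OF that] that(2,3) by (auto simp: mod_Suc split: if_splits)
    show False
      using step[OF a(1) lt(1,2)] step[OF a(2) lt(2,3)] step[OF a(3) lt(1,3)] assms
      by (elim disjE conjE; linarith)
  qed
  then show ?thesis unfolding triangles_def by auto
qed

lemma connected_jfg:
  assumes "q \<ge> 3"
  shows "connected_graph (jfg p q)"
  unfolding connected_graph_def
proof (intro allI impI, rule ccontr)
  let ?J = "jfg p q"
  have wf: "wf_graph ?J" using wf_jfg assms by simp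
  fix S assume S: "S \<subseteq> verts ?J \<and> S \<noteq> {} \<and> S \<noteq> verts ?J"
    and no: "\<not> (\<exists>u\<in>S. \<exists>v\<in>verts ?J - S. adj ?J u v)"
  have cl: "v \<in> S" if "u \<in> S" "adj ?J u v" for u v
    using no that adj_verts[OF wf that(2)] by blast
  from S obtain k where k: "k \<in> S" by blast
  then have "k \<in> verts ?J" using S by blast
  then obtain i where i: "i < q" "i \<in> S"
  proof (cases rule: verts_jfg_cases)
    case 1
    then show ?thesis using k that by blast
  next
    case (2 i j)
    then have "i \<in> S" using cl[OF k, of i] unfolding adj_jfg by blast
    then show ?thesis using 2 that by blast
  qed
  have walk: "(i + m) mod q \<in> S" for m
  proof (induction m)
    case 0
    then show ?case using i by simp
  next
    case (Suc m)
    have "adj ?J ((i + m) mod q) (cyc_succ q ((i + m) mod q))"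
      unfolding adj_jfg using assms by simp
    then show ?case using cl[OF Suc] by (simp add: mod_simps)
  qed
  have cyc: "v \<in> S" if "v < q" for v
  proof -
    \<comment> \<open>The walk from \<open>i\<close> to \<open>v\<close> is lengthened by a full
      turn if necessary, which keeps its length a natural number.\<close>
    have "(i + (q - i + v)) mod q = v" using i that by (simp add: mod_simps)
    then show ?thesis using walk[of "q - i + v"] by simp
  qed
  have "v \<in> S" if "v \<in> verts ?J" for v
    using that
  proof (cases rule: verts_jfg_cases)
    case (2 i j)
    then show ?thesis using cl[OF cyc[of i], of v] unfolding adj_jfg by blast
  qed (use cyc in auto)
  with S show False by blast
qed

text \<open>Plain Gershgorin discs only reach \<open>2 * p + 4\<close>, so the pendant coordinates
  are eliminated first: for \<open>cmod l \<ge> p + 5\<close> each is smaller than its cycle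
  coordinate by a factor of \<open>p + 4\<close> or more. At a cycle coordinate of maximal modulus
  \<open>M\<close> the neighbours then contribute less than \<open>3 * M\<close>, while the row
  equation demands at least that. Strictness matters for the integer degree bound drawn from
  it.\<close>

lemma eigenvalue_jfg_bound:
  assumes q: "q \<ge> 3" and ev: "eigenvalue (map_mat complex_of_real (laplacian (jfg p q))) l"
  shows "cmod l < real p + 5"
proof (rule ccontr)
  let ?J = "jfg p q" let ?n = "q + q * p"
  let ?A = "map_mat complex_of_real (laplacian ?J)"
  assume "\<not> ?thesis"
  then have l: "cmod l \<ge> real p + 5" by simp
  from ev obtain v where v: "v \<in> carrier_vec ?n" "v \<noteq> 0\<^sub>v ?n" "?A *\<^sub>v v = l \<cdot>\<^sub>v v"
    unfolding eigenvalue_def eigenvector_def by auto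
  have eq: "of_nat (degree ?J i) * v $ i - (\<Sum>j\<in>nbrs ?J i. v $ j) = l * v $ i" if "i < ?n" for i
  proof -
    have "(?A *\<^sub>v v) $ i = (\<Sum>j<?n. of_real (laplacian ?J $$ (i, j)) * v $ j)"
      using that v(1) by (auto simp: scalar_prod_def atLeast0LessThan)
    then show ?thesis
      using laplacian_row_sum_of_real[of i ?J "\<lambda>j. v $ j"] v(1,3) that by simp
  qed
  have l1: "cmod (1 - l) \<ge> real p + 4"
    using norm_triangle_ineq2[of l 1] l by (simp add: norm_minus_commute)
  have pend: "cmod (v $ (q + i * p + j)) \<le> cmod (v $ i) / (real p + 4)" if "i < q" "j < p" for i j
  proof -
    have "v $ i = (1 - l) * v $ (q + i * p + j)"
      using eq[OF pendant_index_less[OF that]]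
      unfolding degree_jfg_pendant[OF that] nbrs_jfg_pendant[OF that]
      by (simp add: left_diff_distrib) (simp add: algebra_simps)
    then have "cmod (v $ i) = cmod (1 - l) * cmod (v $ (q + i * p + j))" by (simp add: norm_mult)
    also have "\<dots> \<ge> (real p + 4) * cmod (v $ (q + i * p + j))"
      using l1 by (intro mult_right_mono) auto
    finally show ?thesis by (simp add: field_simps)
  qed
  define M where "M = Max ((\<lambda>i. cmod (v $ i)) ` {..<q})"
  have Mle: "cmod (v $ i) \<le> M" if "i < q" for i
    unfolding M_def using that by auto
  have "M \<in> (\<lambda>i. cmod (v $ i)) ` {..<q}"
    unfolding M_def using q by (intro Max_in) (auto simp: lessThan_empty_iff)
  then obtain i where i: "i < q" "cmod (v $ i) = M" by auto
  have "M \<noteq> 0"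
  proof
    assume "M = 0"
    then have z: "v $ k = 0" if "k < q" for k using Mle[OF that] by simp
    have "v $ k = 0" if "k < ?n" for k
    proof -
      have "k \<in> verts ?J" using that by (simp add: verts_def)
      then show ?thesis
      proof (cases rule: verts_jfg_cases)
        case (2 i j)
        then show ?thesis using pend[OF 2(1,2)] z[OF 2(1)] by simp
      qed (use z in auto)
    qed
    then have "v = 0\<^sub>v ?n" using v(1) by (intro eq_vecI) auto
    with v(2) show False by simp
  qed
  then have M: "M > 0" using i(2) by (metis norm_ge_zero less_eq_real_def)
  let ?a = "cyc_succ q i" and ?b = "if i = 0 then q - 1 else i - 1"
  have ab: "?a < q" "?b < q" using i(1) by (auto split: if_splits)
  have "cmod (\<Sum>j\<in>nbrs ?J i. v $ j) \<le> cmod (\<Sum>j\<in>{?a, ?b}. v $ j) + cmod (\<Sum>j\<in>(\<lambda>j. q + i * p + j) ` {..<p}. v $ j)"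
    unfolding nbrs_jfg_cycle[OF i(1)]
    by (subst sum.union_disjoint[OF _ _ cycle_pendant_disjoint[OF i(1)]]) (auto intro: norm_triangle_ineq)
  also have "cmod (\<Sum>j\<in>{?a, ?b}. v $ j) \<le> of_nat (card {?a, ?b}) * M"
    by (rule sum_norm_bound) (use Mle ab in auto)
  also have "\<dots> \<le> 2 * M" using M by (intro mult_right_mono) (auto simp: card_insert_if)
  also have "cmod (\<Sum>j\<in>(\<lambda>j. q + i * p + j) ` {..<p}. v $ j) \<le>
      of_nat (card ((\<lambda>j. q + i * p + j) ` {..<p})) * (M / (real p + 4))"
    by (rule sum_norm_bound) (use pend[OF i(1)] i(2) in auto)
  also have "\<dots> = real p * (M / (real p + 4))" by (simp add: card_image inj_on_def)
  finally have u: "cmod (\<Sum>j\<in>nbrs ?J i. v $ j) \<le> 2 * M + real p * (M / (real p + 4))" by simp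
  have "(\<Sum>j\<in>nbrs ?J i. v $ j) = (of_nat (p + 2) - l) * v $ i"
    using eq[of i] i(1) q by (simp add: degree_jfg_cycle algebra_simps)
  then have "cmod (\<Sum>j\<in>nbrs ?J i. v $ j) = cmod (l - of_nat (p + 2)) * M"
    by (simp add: norm_mult i(2) norm_minus_commute)
  moreover have "cmod (l - of_nat (p + 2)) \<ge> 3"
    using norm_triangle_ineq2[of l "of_nat (p + 2)"] l unfolding norm_of_nat by simp
  ultimately have "3 * M \<le> 2 * M + real p * (M / (real p + 4))"
    using u M mult_right_mono[of 3 "cmod (l - of_nat (p + 2))" M] by linarith
  moreover have "real p * (M / (real p + 4)) < M" using M by (simp add: field_simps)
  ultimately show False by simp
qed

section \<open>The degree sequence\<close>

definition cut_connected :: "'a set \<Rightarrow> 'a rel \<Rightarrow> bool" where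
  "cut_connected V R \<longleftrightarrow> (\<forall>S. S \<subseteq> V \<and> S \<noteq> {} \<and> S \<noteq> V \<longrightarrow> (\<exists>u\<in>S. \<exists>v\<in>V - S. (u, v) \<in> R))"

text \<open>This is the bound of \<open>n - 1\<close> edges, counted in arcs: a vertex set grown one
  vertex at a time across a cut gains two arcs in each step.\<close>

lemma cut_connected_card_ge:
  assumes "cut_connected V R" and fV: "finite V" and "V \<noteq> {}" and fR: "finite R"
    and sym: "sym R"
  shows "2 * card V \<le> card R + 2"
proof -
  have "\<exists>S. S \<subseteq> V \<and> card S = k \<and> 2 * k \<le> card (R \<inter> S \<times> S) + 2" if "1 \<le> k" "k \<le> card V" for k
    using that
  proof (induction k rule: dec_induct)
    case base
    from assms(3) obtain v where "v \<in> V" by blast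
    then show ?case by (intro exI[of _ "{v}"]) auto
  next
    case (step k)
    then obtain S where S: "S \<subseteq> V" "card S = k" "2 * k \<le> card (R \<inter> S \<times> S) + 2" by auto
    have fS: "finite S" using finite_subset[OF S(1) fV] .
    have "S \<noteq> {}" "S \<noteq> V" using S step by auto
    then obtain u v where uv: "u \<in> S" "v \<in> V - S" "(u, v) \<in> R"
      using assms(1) S(1) unfolding cut_connected_def by blast
    have "(v, u) \<in> R" using uv(3) sym by (meson symD)
    with uv have sub: "(R \<inter> S \<times> S) \<union> {(u, v), (v, u)} \<subseteq> R \<inter> insert v S \<times> insert v S" by auto
    have "card (R \<inter> S \<times> S) + 2 = card ((R \<inter> S \<times> S) \<union> {(u, v), (v, u)})"
    proof -
      have "u \<noteq> v" using uv by blast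
      then have "card {(u, v), (v, u)} = 2" by simp
      moreover have "(R \<inter> S \<times> S) \<inter> {(u, v), (v, u)} = {}" using uv(2) by blast
      ultimately show ?thesis
        using card_Un_disjoint[of "R \<inter> S \<times> S" "{(u, v), (v, u)}"] fR
        by (metis finite.emptyI finite_Int finite_insert)
    qed
    also have "\<dots> \<le> card (R \<inter> insert v S \<times> insert v S)"
      by (rule card_mono[OF _ sub]) (use fR in auto)
    finally have "2 * Suc k \<le> card (R \<inter> insert v S \<times> insert v S) + 2" using S(3) by simp
    moreover have "card (insert v S) = Suc k" using uv fS S(2) by simp
    moreover have "insert v S \<subseteq> V" using uv S(1) by auto
    ultimately show ?case by blast
  qed
  moreover have "card V \<ge> 1" using fV assms(3) by (simp add: Suc_leI card_gt_0_iff)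
  ultimately obtain S where "S \<subseteq> V" "card S = card V" "2 * card V \<le> card (R \<inter> S \<times> S) + 2" by blast
  moreover have "card (R \<inter> S \<times> S) \<le> card R" for S by (rule card_mono[OF fR]) auto
  ultimately show ?thesis by (meson add_le_mono1 order_trans)
qed

text \<open>An edge of a triangle is not a bridge: in a cut that separates \<open>x\<close> from
  \<open>y\<close> the third vertex \<open>z\<close> is on one side, so one of its two edges crosses
  the cut. Working with a bare relation allows repeated deletion.\<close>

lemma cut_connected_remove:
  assumes "cut_connected V R" and "sym R" and "(x, z) \<in> R" and "(z, y) \<in> R" and "z \<in> V"
    and "z \<noteq> x" and "z \<noteq> y"
  shows "cut_connected V (R - {(x, y), (y, x)})"
  unfolding cut_connected_def
proof (intro allI impI)
  fix S assume S: "S \<subseteq> V \<and> S \<noteq> {} \<and> S \<noteq> V"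
  then obtain u v where uv: "u \<in> S" "v \<in> V - S" "(u, v) \<in> R"
    using assms(1) unfolding cut_connected_def by blast
  have zx: "(z, x) \<in> R" "(y, z) \<in> R" using assms(2-4) by (meson symD)+
  show "\<exists>u\<in>S. \<exists>v\<in>V - S. (u, v) \<in> R - {(x, y), (y, x)}"
  proof (cases "(u, v) \<in> {(x, y), (y, x)}")
    case True
    then show ?thesis
      using uv zx assms(3-7) by (cases "z \<in> S") auto
  qed (use uv in blast)
qed

definition arcs :: "graph \<Rightarrow> nat rel" where
  "arcs G = {(u, v). adj G u v}"

lemma arcs_Sigma: "wf_graph G \<Longrightarrow> arcs G = Sigma (verts G) (nbrs G)"
  by (auto simp: arcs_def mem_nbrs dest: adj_verts)

lemma finite_arcs: "wf_graph G \<Longrightarrow> finite (arcs G)"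
  by (simp add: arcs_Sigma)

lemma card_arcs: "wf_graph G \<Longrightarrow> card (arcs G) = (\<Sum>v\<in>verts G. degree G v)"
  by (simp add: arcs_Sigma degree_eq_card_nbrs)

lemma sym_arcs: "sym (arcs G)"
  by (auto simp: sym_def arcs_def adj_commute)

lemma connected_graph_cut_connected: "connected_graph G \<longleftrightarrow> cut_connected (verts G) (arcs G)"
  by (simp add: connected_graph_def cut_connected_def arcs_def)

text \<open>Of two different triangles, each can lose one edge without disconnecting the graph. With
  at most \<open>n\<close> edges to start from, fewer than the \<open>n - 1\<close> needed would
  remain.\<close>

lemma unicyclic_triangles_same_set:
  assumes wf: "wf_graph G" and con: "connected_graph G"
    and deg: "(\<Sum>v\<in>verts G. degree G v) \<le> 2 * card (verts G)"
    and t1: "(a, b, c) \<in> triangles G" and t2: "(d, e, f) \<in> triangles G"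
  shows "{a, b, c} = {d, e, f}"
proof (rule ccontr)
  assume ne: "{a, b, c} \<noteq> {d, e, f}"
  have irr: "\<not> adj G u u" for u by (rule adj_irrefl[OF wf])
  have c: "card {a, b, c} = 3" "card {d, e, f} = 3"
    using t1 t2 irr by (auto simp: triangles_def card_insert_if)
  have "\<not> {a, b, c} \<subseteq> {d, e, f}"
    using card_subset_eq[of "{d, e, f}" "{a, b, c}"] c ne by auto
  then consider "a \<notin> {d, e, f}" | "b \<notin> {d, e, f}" | "c \<notin> {d, e, f}" by blast
  moreover have "adj G a b" "adj G b c" "adj G a c" "adj G b a" "adj G c b" "adj G c a"
    using t1 by (auto simp: triangles_def adj_commute)
  \<comment> \<open>The deleted edge has an end \<open>x\<close> outside the second triangle, so
    that triangle survives the first deletion and the four deleted arcs are distinct.\<close>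
  ultimately obtain x y z where x: "x \<notin> {d, e, f}" and xyz: "adj G x y" "adj G y z" "adj G x z"
    by cases blast+
  let ?R1 = "arcs G - {(x, y), (y, x)}" let ?R2 = "?R1 - {(d, e), (e, d)}"
  have 1: "cut_connected (verts G) ?R1"
    by (rule cut_connected_remove[where z = z])
      (use con xyz irr adj_verts[OF wf] sym_arcs in
        \<open>auto simp: connected_graph_cut_connected arcs_def adj_commute\<close>)
  have s1: "sym ?R1" using sym_arcs[of G] by (auto simp: sym_def)
  have 2: "cut_connected (verts G) ?R2"
    by (rule cut_connected_remove[where z = f, OF 1 s1])
      (use t2 irr adj_verts[OF wf] x in \<open>auto simp: triangles_def arcs_def adj_commute\<close>)
  have s2: "sym ?R2" using sym_arcs[of G] by (auto simp: sym_def)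
  have fin: "finite (arcs G)" by (rule finite_arcs[OF wf])
  have "x \<noteq> y" "d \<noteq> e" using xyz t2 irr by (auto simp: triangles_def)
  then have "card {(x, y), (y, x), (d, e), (e, d)} = 4"
    using x by (auto simp: card_insert_if)
  moreover have "{(x, y), (y, x), (d, e), (e, d)} \<subseteq> arcs G"
    using xyz t2 by (auto simp: triangles_def arcs_def adj_commute)
  moreover have "?R2 = arcs G - {(x, y), (y, x), (d, e), (e, d)}" by auto
  ultimately have "card ?R2 = card (arcs G) - 4" "card (arcs G) \<ge> 4"
    using card_Diff_subset[of "{(x, y), (y, x), (d, e), (e, d)}" "arcs G"]
      card_mono[OF fin, of "{(x, y), (y, x), (d, e), (e, d)}"] by auto
  moreover have "2 * card (verts G) \<le> card ?R2 + 2"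
    by (rule cut_connected_card_ge[OF 2 _ _ _ s2]) (use fin adj_verts[OF wf xyz(1)] in auto)
  ultimately show False using deg card_arcs[OF wf] by linarith
qed

text \<open>All triangles share one vertex set, which carries six ordered triples.\<close>

lemma unicyclic_card_triangles:
  assumes wf: "wf_graph G" and con: "connected_graph G"
    and deg: "(\<Sum>v\<in>verts G. degree G v) \<le> 2 * card (verts G)"
  shows "triangles G = {} \<or> card (triangles G) = 6"
proof (cases "triangles G = {}")
  case False
  then obtain a b c where t: "(a, b, c) \<in> triangles G" by auto
  have ne: "a \<noteq> b" "b \<noteq> c" "a \<noteq> c" using t adj_irrefl[OF wf] by (auto simp: triangles_def)
  have "triangles G = {(a,b,c), (a,c,b), (b,a,c), (b,c,a), (c,a,b), (c,b,a)}"
  proof (rule equalityI; rule subsetI)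
    fix x assume x: "x \<in> triangles G"
    obtain d e f where xd: "x = (d, e, f)" by (cases x) auto
    have "{a, b, c} = {d, e, f}"
      by (rule unicyclic_triangles_same_set[OF assms t]) (use x xd in simp)
    moreover have "d \<noteq> e" "e \<noteq> f" "d \<noteq> f"
      using x adj_irrefl[OF wf] by (auto simp: triangles_def xd)
    ultimately have "d \<in> {a, b, c}" "e \<in> {a, b, c}" "f \<in> {a, b, c}" "d \<noteq> e" "e \<noteq> f" "d \<noteq> f"
      by auto
    then show "x \<in> {(a,b,c), (a,c,b), (b,a,c), (b,c,a), (c,a,b), (c,b,a)}"
      unfolding xd by auto
  next
    fix x assume "x \<in> {(a,b,c), (a,c,b), (b,a,c), (b,c,a), (c,a,b), (c,b,a)}"
    then show "x \<in> triangles G" using t by (auto simp: triangles_def adj_commute)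
  qed
  then show ?thesis using ne by (simp add: card_insert_if)
qed simp

section \<open>Degrees of a graph cospectral with the jellyfish graph\<close>

lemma connected_degree_pos:
  assumes wf: "wf_graph G" and con: "connected_graph G" and v: "v \<in> verts G" and "card (verts G) > 1"
  shows "degree G v > 0"
proof -
  have "{v} \<noteq> verts G"
  proof
    assume "{v} = verts G"
    then have "card (verts G) = card {v}" by simp
    with assms(4) show False by simp
  qed
  then obtain w where "adj G v w"
    using con v unfolding connected_graph_def by (metis empty_not_insert empty_subsetI insert_subset singletonD)
  then have "nbrs G v \<noteq> {}" using mem_nbrs[OF wf] by auto
  then show ?thesis by (simp add: degree_eq_card_nbrs card_gt_0_iff)
qed

text \<open>The three traces fix the power sums of the degrees, the third up to the triangle count.
  The last two sums combine them into polynomials that vanish at the jellyfish degrees 1 and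
  \<open>p + 2\<close>; since the jellyfish graph has no triangles, only those of \<open>H\<close>
  remain.\<close>

lemma cospectral_jfg_degree_sums:
  assumes q: "q \<ge> 4" and wf: "wf_graph H" and co: "L_cospectral H (jfg p q)"
  defines "n \<equiv> q + q * p" and "d \<equiv> \<lambda>v. real (degree H v)"
  shows "fst H = n"
    and "(\<Sum>v<n. d v) = 2 * real n"
    and "(\<Sum>v<n. (d v - 1) * (d v - (real p + 2))) = 0"
    and "(\<Sum>v<n. (d v - 1) * (d v - (real p + 2)) * (d v - (real p + 3))) = real (card (triangles H))"
proof -
  let ?J = "jfg p q"
  show n: "fst H = n" using L_cospectral_order[OF co] by (simp add: n_def)
  have wfJ: "wf_graph ?J" using wf_jfg q by simp
  have H: "laplacian H \<in> carrier_mat n n" and J: "laplacian ?J \<in> carrier_mat n n"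
    using laplacian_carrier[of H] laplacian_carrier[of ?J] n by (simp_all add: n_def)
  have tr: "trace (laplacian H ^\<^sub>m k) = trace (laplacian ?J ^\<^sub>m k)" for k
    by (rule trace_pow_cong[OF H J L_cospectral_char_poly[OF co]])
  have pow: "A ^\<^sub>m 1 = A \<and> A ^\<^sub>m 2 = A * A \<and> A ^\<^sub>m 3 = A * (A * A)"
    if A: "A \<in> carrier_mat n n" for A :: "real mat"
    using that assoc_mult_mat[OF A A A] by (simp add: numeral_2_eq_2 numeral_3_eq_3)
  have fJ: "fst ?J = n" by (simp add: n_def)
  have J_sum: "(\<Sum>i<n. real (degree ?J i) ^ k) = real q * (real p + 2) ^ k + real q * real p" for k
    using sum_degree_jfg[of q "\<lambda>d. real d ^ k" p] q by (simp add: n_def add.commute)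
  have 1: "(\<Sum>v<n. d v) = real q * (real p + 2) + real q * real p"
    using tr[of 1] J_sum[of 1] unfolding conjunct1[OF pow[OF H]] conjunct1[OF pow[OF J]]
      trace_laplacian[OF wf] trace_laplacian[OF wfJ] n fJ d_def by simp
  have 2: "(\<Sum>v<n. d v ^ 2) = real q * (real p + 2) ^ 2 + real q * real p"
    using tr[of 2] J_sum[of 2] J_sum[of 1] 1
    unfolding conjunct1[OF conjunct2[OF pow[OF H]]] conjunct1[OF conjunct2[OF pow[OF J]]]
      trace_laplacian_sq[OF wf] trace_laplacian_sq[OF wfJ] n fJ d_def by simp
  have 3: "(\<Sum>v<n. d v ^ 3) = real q * (real p + 2) ^ 3 + real q * real p + real (card (triangles H))"
    using tr[of 3] J_sum[of 3] J_sum[of 2] 2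
    unfolding conjunct2[OF conjunct2[OF pow[OF H]]] conjunct2[OF conjunct2[OF pow[OF J]]]
      trace_laplacian_cube[OF wf] trace_laplacian_cube[OF wfJ] n fJ d_def triangles_jfg[OF q]
    by (simp add: algebra_simps)
  have 0: "(\<Sum>v<n. 1 :: real) = real q + real q * real p" by (simp add: n_def)
  show "(\<Sum>v<n. d v) = 2 * real n" unfolding 1 by (simp add: n_def algebra_simps)
  let ?r = "real p + 2" let ?s = "real p + 3"
  have "(\<Sum>v<n. (d v - 1) * (d v - ?r)) = (\<Sum>v<n. d v ^ 2 - (1 + ?r) * d v + ?r * 1)"
    by (rule sum.cong) (auto simp: power2_eq_square algebra_simps)
  also have "\<dots> = (\<Sum>v<n. d v ^ 2) - (1 + ?r) * (\<Sum>v<n. d v) + ?r * (\<Sum>v<n. 1)"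
    unfolding sum.distrib sum_subtractf sum_distrib_left ..
  also have "\<dots> = 0"
    unfolding 0 1 2 by (simp add: power2_eq_square algebra_simps)
  finally show "(\<Sum>v<n. (d v - 1) * (d v - (real p + 2))) = 0" .
  have "(\<Sum>v<n. (d v - 1) * (d v - ?r) * (d v - ?s)) =
      (\<Sum>v<n. d v ^ 3 - (1 + ?r + ?s) * d v ^ 2 + (?r + ?s + ?r * ?s) * d v - ?r * ?s * 1)"
    by (rule sum.cong) (auto simp: power2_eq_square power3_eq_cube algebra_simps)
  also have "\<dots> = (\<Sum>v<n. d v ^ 3) - (1 + ?r + ?s) * (\<Sum>v<n. d v ^ 2) + (?r + ?s + ?r * ?s) * (\<Sum>v<n. d v)
      - ?r * ?s * (\<Sum>v<n. 1)"
    unfolding sum.distrib sum_subtractf sum_distrib_left ..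
  also have "\<dots> = real (card (triangles H))"
    unfolding 0 1 2 3 by (simp add: power2_eq_square power3_eq_cube algebra_simps)
  finally show "(\<Sum>v<n. (d v - 1) * (d v - (real p + 2)) * (d v - (real p + 3))) = real (card (triangles H))" .
qed

lemma cospectral_jfg_degree_le:
  assumes q: "q \<ge> 4" and wf: "wf_graph H" and co: "L_cospectral H (jfg p q)" and v: "v \<in> verts H"
  shows "degree H v \<le> p + 3"
proof (cases "degree H v = 0")
  case False
  let ?J = "jfg p q" let ?c = "map_mat complex_of_real"
  let ?E = "{l. poly (char_poly (?c (laplacian ?J))) l = 0}"
  have cJ: "?c (laplacian ?J) \<in> carrier_mat (q + q * p) (q + q * p)"
    using laplacian_carrier[of ?J] by simp
  have cH: "?c (laplacian H) \<in> carrier_mat (q + q * p) (q + q * p)"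
    using laplacian_carrier[of H] L_cospectral_order[OF co] by simp
  have eq: "char_poly (?c (laplacian H)) = char_poly (?c (laplacian ?J))"
    using of_real_hom.char_poly_hom[OF laplacian_carrier] L_cospectral_char_poly[OF co] by metis
  have fin: "finite ?E"
    using degree_monic_char_poly[OF cJ] by (intro poly_roots_finite) auto
  \<comment> \<open>There are finitely many eigenvalues, so their largest modulus is still strictly
    below \<open>p + 5\<close>; this strictness excludes the degree \<open>p + 4\<close>. Inserting
    0 gives \<open>r \<ge> 0\<close>.\<close>
  define r where "r = Max (insert 0 (cmod ` ?E))"
  have lt: "r < real p + 5"
    unfolding r_def using fin eigenvalue_jfg_bound[of q p] q
    by (auto simp: eigenvalue_root_char_poly[OF cJ])
  have "cmod l \<le> r" if "eigenvalue (?c (laplacian H)) l" for l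
    using that fin unfolding eigenvalue_root_char_poly[OF cH] eq r_def by auto
  moreover have "r \<ge> 0" unfolding r_def using fin by auto
  ultimately have "real (degree H v) + 1 \<le> r"
    using False by (intro degree_Suc_le_spectral_bound[OF wf v]) auto
  with lt show ?thesis by linarith
qed simp

text \<open>With \<open>h(d) = (d - 1) (p + 2 - d)\<close> the degree sums say \<open>\<Sum> h(d) = 0\<close> and
  \<open>\<Sum> h(d) (p + 3 - d) = 6 t\<close> for \<open>t \<le> 1\<close> triangles; the summands of the second sum are nonnegative.\<close>

lemma cospectral_jfg_degrees_or_exception:
  assumes p: "p \<ge> 1" and q: "q \<ge> 4" and wf: "wf_graph H" and co: "L_cospectral H (jfg p q)"
  shows "(\<forall>v\<in>verts H. degree H v = 1 \<or> degree H v = p + 2) \<or>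
    (p = 1 \<and> card {v \<in> verts H. degree H v = 1} = q - 1)"
proof -
  let ?n = "q + q * p" let ?V = "{..<?n}"
  have wfJ: "wf_graph (jfg p q)" using wf_jfg q by simp
  have con: "connected_graph H"
    by (rule connected_graph_cospectral[OF wfJ wf co]) (use connected_jfg q in simp)
  note sums = cospectral_jfg_degree_sums[OF q wf co]
  have V: "verts H = ?V" using sums(1) by (auto simp: verts_def)
  have pos: "degree H v \<ge> 1" if "v < ?n" for v
    using connected_degree_pos[OF wf con, of v] that q by (simp add: V)
  have le: "degree H v \<le> p + 3" if "v < ?n" for v
    using cospectral_jfg_degree_le[OF q wf co, of v] that by (simp add: V)
  define d where "d v = real (degree H v)" for v
  define h where "h v = (d v - 1) * (real p + 2 - d v)" for v
  have h0: "(\<Sum>v<?n. h v) = 0"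
    using sums(3) by (simp add: h_def d_def algebra_simps sum_subtractf sum.distrib)
  have g: "(\<Sum>v<?n. h v * (real p + 3 - d v)) = real (card (triangles H))"
  proof -
    have "h v * (real p + 3 - d v) = (d v - 1) * (d v - (real p + 2)) * (d v - (real p + 3))" for v
      by (simp add: h_def algebra_simps)
    then show ?thesis using sums(4) by (simp add: d_def)
  qed
  have hz: "h v = 0 \<longleftrightarrow> degree H v = 1 \<or> degree H v = p + 2" for v
    unfolding h_def d_def by auto
  \<comment> \<open>Below \<open>p + 2\<close> the factor \<open>p + 3 - d\<close> is at least 2, so
    such vertices contribute at most half as much to the quadratic sum as to the cubic one. This
    factor 2 is what later forces \<open>p = 1\<close>.\<close>
  have dcase: "degree H v = p + 3 \<or> (h v \<ge> 0 \<and> 2 * h v \<le> h v * (real p + 3 - d v))" if "v < ?n" for v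
  proof (cases "degree H v \<ge> p + 2")
    case True
    then have "degree H v = p + 2 \<or> degree H v = p + 3" using le[OF that] by linarith
    then show ?thesis using hz[of v] by auto
  next
    case False
    then have "d v \<le> real p + 1" "d v \<ge> 1" using pos[OF that] by (auto simp: d_def)
    then have "h v \<ge> 0" "real p + 3 - d v \<ge> 2" unfolding h_def by auto
    then show ?thesis using mult_left_mono[of 2 "real p + 3 - d v" "h v"] by auto
  qed
  have gnn: "h v * (real p + 3 - d v) \<ge> 0" if "v < ?n" for v
    using dcase[OF that] by (auto simp: d_def)
  have degsum: "(\<Sum>v<?n. degree H v) = 2 * ?n"
    using sums(2) unfolding of_nat_sum[symmetric] by linarith
  have "triangles H = {} \<or> card (triangles H) = 6"
    using degsum by (intro unicyclic_card_triangles[OF wf con]) (simp add: V)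
  then show ?thesis
  proof
    assume "triangles H = {}"
    then have "\<forall>v\<in>?V. h v * (real p + 3 - d v) = 0"
      using sum_nonneg_eq_0_iff[of ?V "\<lambda>v. h v * (real p + 3 - d v)"] g gnn by simp
    then have e: "h v = 0 \<or> degree H v = p + 3" if "v < ?n" for v using that by (auto simp: d_def)
    \<comment> \<open>Without triangles only degrees with \<open>h v = 0\<close> or degree
      \<open>p + 3\<close> remain, and the latter has \<open>h v = - (p + 2)\<close>, which nothing
      could balance.\<close>
    have "h v \<le> 0" if "v < ?n" for v
      using e[OF that] by (auto simp: h_def d_def)
    then have "\<forall>v\<in>?V. - h v = 0"
      using sum_nonneg_eq_0_iff[of ?V "\<lambda>v. - h v"] h0 by (simp add: sum_negf)
    then show ?thesis using hz by (auto simp: V)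
  next
    assume t: "card (triangles H) = 6"
    define A where "A = {v. v < ?n \<and> degree H v = p + 3}"
    define B where "B = ?V - A"
    have AB: "?V = A \<union> B" "A \<inter> B = {}" "finite A" "finite B" by (auto simp: A_def B_def)
    have hA: "(\<Sum>v\<in>A. h v) = - ((real p + 2) * real (card A))"
      by (simp add: A_def h_def d_def algebra_simps)
    have split: "(\<Sum>v<?n. f v) = (\<Sum>v\<in>A. f v) + (\<Sum>v\<in>B. f v)" for f :: "nat \<Rightarrow> real"
      unfolding AB(1) by (rule sum.union_disjoint) (use AB in auto)
    \<comment> \<open>Each vertex of degree \<open>p + 3\<close> must be balanced by
      \<open>p + 2\<close> units of \<open>h\<close> on the others, and one triangle provides at
      most \<open>6 / 2 = 3\<close> units in all: hence \<open>p = 1\<close> and a single vertex of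
      degree 4.\<close>
    have hB: "(\<Sum>v\<in>B. h v) = (real p + 2) * real (card A)" using h0 hA split[of h] by linarith
    have Bnn: "h v \<ge> 0" "2 * h v \<le> h v * (real p + 3 - d v)" if "v \<in> B" for v
      using dcase[of v] that by (auto simp: A_def B_def)
    have gB: "(\<Sum>v\<in>B. h v * (real p + 3 - d v)) = 6"
      using g t split[of "\<lambda>v. h v * (real p + 3 - d v)"] by (simp add: A_def d_def)
    have "2 * (\<Sum>v\<in>B. h v) \<le> 6"
      unfolding gB[symmetric] sum_distrib_left by (rule sum_mono) (rule Bnn)
    with hB have le3: "(real p + 2) * real (card A) \<le> 3" by linarith
    have "card A \<noteq> 0"
    proof
      assume "card A = 0"
      then have "\<forall>v\<in>B. h v = 0"
        using sum_nonneg_eq_0_iff[of B h] hB Bnn(1) AB(4) by simp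
      then show False using gB by simp
    qed
    then have "real (card A) \<ge> 1" by simp
    then have "(real p + 2) * 1 \<le> (real p + 2) * real (card A)" by (intro mult_left_mono) auto
    from order_trans[OF this le3] have "real p \<le> 1" by simp
    then have p1: "p = 1" using p by simp
    have A1: "card A = 1" using le3 p1 \<open>card A \<noteq> 0\<close> by simp
    define N where "N k = card {v. v < ?n \<and> degree H v = k}" for k
    have N: "real (N k) = (\<Sum>v<?n. if degree H v = k then 1 else 0)" for k
      unfolding N_def by (simp flip: sum.inter_filter add: lessThan_def Collect_conj_eq[symmetric])
    have four: "degree H v = 1 \<or> degree H v = 2 \<or> degree H v = 3 \<or> degree H v = 4" if "v < ?n" for v
      using pos[OF that] le[OF that] p1 by auto
    have count: "(\<Sum>v<?n. f (degree H v)) =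
        f 1 * real (N 1) + f 2 * real (N 2) + f 3 * real (N 3) + f 4 * real (N 4)" for f :: "nat \<Rightarrow> real"
      unfolding N sum_distrib_left sum.distrib[symmetric] by (rule sum.cong) (use four in auto)
    have s0: "2 * real q = real (N 1) + real (N 2) + real (N 3) + real (N 4)"
      using count[of "\<lambda>_. 1"] p1 by simp
    have s1: "4 * real q = real (N 1) + 2 * real (N 2) + 3 * real (N 3) + 4 * real (N 4)"
      using count[of real] sums(2) p1 by simp
    have s2: "0 = real (N 2) - 3 * real (N 4)"
      using count[of "\<lambda>k. (real k - 1) * (real p + 2 - real k)"] h0 p1 by (simp add: h_def d_def)
    have "N 4 = 1" using A1 p1 by (simp add: N_def A_def)
    then have "real (N 1) = real q - 1" using s0 s1 s2 by simp
    then have "N 1 = q - 1" using q by linarith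
    moreover have "{v \<in> verts H. degree H v = 1} = {v. v < ?n \<and> degree H v = 1}" by (auto simp: V)
    ultimately show ?thesis using p1 by (simp add: N_def)
  qed
qed

section \<open>Elimination of the leaves\<close>

text \<open>Triangularity up to a simultaneous permutation of rows and columns.\<close>

lemma det_ranked:
  fixes A :: "'a::comm_ring_1 mat" and rk :: "nat \<Rightarrow> nat"
  assumes A: "A \<in> carrier_mat n n"
    and z: "\<And>i j. i < n \<Longrightarrow> j < n \<Longrightarrow> i \<noteq> j \<Longrightarrow> rk j \<le> rk i \<Longrightarrow> A $$ (i, j) = 0"
  shows "det A = (\<Prod>i<n. A $$ (i, i))"
proof -
  have "(\<Prod>i = 0..<n. A $$ (i, p i)) = 0" if p: "p permutes {0..<n}" and ne: "p \<noteq> id" for p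
  proof (rule ccontr)
    assume nz: "(\<Prod>i = 0..<n. A $$ (i, p i)) \<noteq> 0"
    have lt: "p i < n" if "i < n" for i using permutes_in_image[OF p, of i] that by simp
    have up: "p i = i \<or> rk i < rk (p i)" if "i < n" for i
    proof (rule ccontr)
      assume "\<not> ?thesis"
      then have "A $$ (i, p i) = 0" using z[of i "p i"] lt[OF that] that by auto
      then have "(\<Prod>i = 0..<n. A $$ (i, p i)) = 0"
        using that by (subst prod.remove[of _ i]) auto
      with nz show False by simp
    qed
    from ne obtain i where i: "p i \<noteq> i" by (auto simp: fun_eq_iff)
    then have "i < n" using p by (auto simp: permutes_def)
    \<comment> \<open>A permutation with a nonzero product raises the rank wherever it moves a
      point, but the total rank is invariant under permutation.\<close>
    have "(\<Sum>i = 0..<n. rk i) < (\<Sum>i = 0..<n. rk (p i))"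
    proof (rule sum_strict_mono_ex1)
      show "\<forall>i\<in>{0..<n}. rk i \<le> rk (p i)" using up by (metis atLeastLessThan_iff less_imp_le order_refl)
      show "\<exists>i\<in>{0..<n}. rk i < rk (p i)" using up[OF \<open>i < n\<close>] i \<open>i < n\<close> by auto
    qed simp
    moreover have "(\<Sum>i = 0..<n. rk (p i)) = (\<Sum>i = 0..<n. rk i)"
      using sum.permute[OF p, of rk] by (simp add: comp_def)
    ultimately show False by simp
  qed
  then have "det A = (\<Sum>p\<in>{id}. signof p * (\<Prod>i = 0..<n. A $$ (i, p i)))"
    unfolding det_def'[OF A]
    by (intro sum.mono_neutral_right) (auto simp: finite_permutations permutes_id)
  then show ?thesis by (simp add: sign_id atLeast0LessThan)
qed

definition leaves :: "graph \<Rightarrow> nat set" where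
  "leaves G = {v \<in> verts G. degree G v = 1}"

definition pendants :: "graph \<Rightarrow> nat \<Rightarrow> nat set" where
  "pendants G v = nbrs G v \<inter> leaves G"

definition supports :: "graph \<Rightarrow> nat set" where
  "supports G = {v \<in> verts G. pendants G v \<noteq> {}}"

lemma finite_leaves[simp]: "finite (leaves G)" and finite_supports[simp]: "finite (supports G)"
  and finite_pendants[simp]: "finite (pendants G v)"
  by (simp_all add: leaves_def supports_def pendants_def)

text \<open>The matrix left over from \<open>x - L\<close> after eliminating the leaves, padded with an identity block.\<close>

definition core_mat :: "graph \<Rightarrow> 'a::comm_ring_1 \<Rightarrow> 'a mat" where
  "core_mat G x = mat (fst G) (fst G) (\<lambda>(i, j).
     if i \<in> leaves G then if i = j then 1 else 0
     else if j \<in> leaves G then 0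
     else ((if i = j then x - of_nat (degree G i) else 0) + (if adj G i j then 1 else 0))
        * (if j \<in> supports G then x - 1 else 1)
        - (if i = j then of_nat (card (pendants G i)) else 0))"

lemma leaf_nbr_unique:
  assumes "wf_graph G" and "l \<in> leaves G" and "adj G l v" and "adj G l w"
  shows "v = w"
proof -
  have "card (nbrs G l) = 1" using assms(2) by (simp add: leaves_def degree_eq_card_nbrs)
  moreover have "v \<in> nbrs G l" "w \<in> nbrs G l" using assms by (simp_all add: mem_nbrs)
  ultimately show ?thesis by (metis card_1_singletonE singletonD)
qed

text \<open>Two adjacent leaves would form a component of their own.\<close>

lemma leaf_not_adj_leaf:
  assumes wf: "wf_graph G" and con: "connected_graph G" and n: "fst G \<ge> 3"
    and l: "l \<in> leaves G" "l' \<in> leaves G"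
  shows "\<not> adj G l l'"
proof
  assume a: "adj G l l'"
  have "card {l, l'} \<le> 2" by (simp add: card_insert_if)
  moreover have "card (verts G) \<ge> 3" using n by (simp add: verts_def)
  ultimately have "{l, l'} \<noteq> verts G" by auto
  moreover have "{l, l'} \<subseteq> verts G" using l by (auto simp: leaves_def)
  ultimately obtain u v where uv: "u \<in> {l, l'}" "v \<in> verts G - {l, l'}" "adj G u v"
    using con unfolding connected_graph_def by (metis insert_not_empty)
  have "adj G l' l" using a adj_commute by blast
  then show False using uv leaf_nbr_unique[OF wf l(1), of v l'] leaf_nbr_unique[OF wf l(2), of v l] a by auto
qed

lemma sum_pendants:
  assumes wf: "wf_graph G" and "connected_graph G" and "fst G \<ge> 3"
  shows "(\<Sum>v\<in>supports G. card (pendants G v)) = card (leaves G)"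
    and "supports G \<inter> leaves G = {}"
proof -
  have "(\<Sum>v\<in>supports G. card (pendants G v)) = card (\<Union>v\<in>supports G. pendants G v)"
  proof (rule card_UN_disjoint[symmetric])
    show "\<forall>i\<in>supports G. \<forall>j\<in>supports G. i \<noteq> j \<longrightarrow> pendants G i \<inter> pendants G j = {}"
      using leaf_nbr_unique[OF wf] mem_nbrs[OF wf] adj_commute
      unfolding pendants_def by blast
  qed simp_all
  also have "(\<Union>v\<in>supports G. pendants G v) = leaves G"
  proof
    show "leaves G \<subseteq> (\<Union>v\<in>supports G. pendants G v)"
    proof
      fix l assume l: "l \<in> leaves G"
      then have "card (nbrs G l) = 1" by (simp add: leaves_def degree_eq_card_nbrs)
      then obtain v where "nbrs G l = {v}" by (rule card_1_singletonE)
      then have "v \<in> verts G" "adj G v l" by (auto simp: nbrs_def adj_commute)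
      then have "l \<in> pendants G v" using l wf by (simp add: pendants_def mem_nbrs)
      then show "l \<in> (\<Union>v\<in>supports G. pendants G v)"
        using \<open>v \<in> verts G\<close> by (auto simp: supports_def)
    qed
  qed (auto simp: pendants_def)
  finally show "(\<Sum>v\<in>supports G. card (pendants G v)) = card (leaves G)" .
  show "supports G \<inter> leaves G = {}"
    using leaf_not_adj_leaf[OF assms] mem_nbrs[OF wf] by (auto simp: supports_def pendants_def)
qed

text \<open>Right multiplication by \<open>T\<close> clears the leaf rows outside their diagonal block: the column of a
  support vertex is scaled by \<open>x - 1\<close> and the columns of its leaves are subtracted.\<close>

lemma char_poly_leaf_elimination:
  assumes wf: "wf_graph G" and con: "connected_graph G" and n: "fst G \<ge> 3"
  shows "char_poly (laplacian G) * [:-1, 1:] ^ card (supports G) =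
    [:-1, 1:] ^ card (leaves G) * det (core_mat G [:0, 1:])"
proof -
  let ?n = "fst G" and ?L = "leaves G" and ?S = "supports G"
  let ?x = "[:0, 1:] :: real poly" and ?y = "[:-1, 1:] :: real poly"
  let ?a = "\<lambda>i j. if adj G i j then 1 else 0 :: real poly"
  have y: "?x - 1 = ?y" by (simp add: one_pCons)
  note disj = sum_pendants(2)[OF assms]
  note nll = leaf_not_adj_leaf[OF assms]
  let ?M = "char_poly_matrix (laplacian G)"
  define X where "X = core_mat G ?x"
  define T where "T = mat ?n ?n (\<lambda>(i, j). if i = j then if j \<in> ?S then ?y else 1
    else if i \<in> ?L \<and> j \<in> ?S \<and> adj G i j then -1 else 0)"
  \<comment> \<open>\<open>Y\<close> has the columns of \<open>x - L\<close> at the leaves and unit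
    columns elsewhere. In \<open>?M * T = Y * X\<close> both \<open>T\<close> and \<open>Y\<close>
    are triangular once leaves are separated from the rest, so their determinants are powers of
    \<open>x - 1\<close>.\<close>
  define Y where "Y = mat ?n ?n (\<lambda>(i, j). if i = j then if j \<in> ?L then ?y else 1
    else if i \<notin> ?L \<and> j \<in> ?L then ?a i j else 0)"
  have M: "?M \<in> carrier_mat ?n ?n" by simp
  have X: "X \<in> carrier_mat ?n ?n" and T: "T \<in> carrier_mat ?n ?n" and Y: "Y \<in> carrier_mat ?n ?n"
    by (simp_all add: X_def core_mat_def T_def Y_def)
  have Mij: "?M $$ (i, j) = (if i = j then ?x - of_nat (degree G i) else 0) + ?a i j"
    if "i < ?n" "j < ?n" for i j
    using that adj_irrefl[OF wf]
    by (auto simp: char_poly_matrix_index[OF laplacian_carrier] laplacian_index of_nat_poly one_pCons)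
  have sumsub: "(\<Sum>k<?n. if k \<in> ?L \<and> P k then f k else 0) = (\<Sum>k\<in>{k \<in> ?L. P k}. f k)"
    for f :: "nat \<Rightarrow> real poly" and P
  proof -
    have "{k \<in> ?L. P k} = {k \<in> {..<?n}. k \<in> ?L \<and> P k}" by (auto simp: leaves_def verts_def)
    then show ?thesis by (simp only: sum.inter_filter[OF finite_lessThan])
  qed
  have "?M * T = Y * X"
  proof (rule eq_matI)
    fix i j assume "i < dim_row (Y * X)" "j < dim_col (Y * X)"
    then have i: "i < ?n" and j: "j < ?n" using X Y by auto
    have jN: "j \<notin> ?L" if "j \<in> ?S" using disj that by auto
    have lhs: "(?M * T) $$ (i, j) = ?M $$ (i, j) * (if j \<in> ?S then ?y else 1)
      - (if j \<in> ?S then \<Sum>k\<in>{k \<in> ?L. adj G k j}. ?M $$ (i, k) else 0)"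
    proof -
      have "(?M * T) $$ (i, j) = (\<Sum>k<?n. (if k = j then ?M $$ (i, j) * (if j \<in> ?S then ?y else 1) else 0)
          - (if k \<in> ?L \<and> adj G k j then if j \<in> ?S then ?M $$ (i, k) else 0 else 0))"
        unfolding mat_mult_index_sum[OF M T i j]
        by (rule sum.cong) (use j jN adj_irrefl[OF wf] in \<open>auto simp: T_def\<close>)
      then show ?thesis using j by (simp add: sum_subtractf sumsub)
    qed
    have rhs: "(Y * X) $$ (i, j) = (if i \<in> ?L then ?y * X $$ (i, j)
        else X $$ (i, j) + (\<Sum>k\<in>?L. ?a i k * X $$ (k, j)))"
    proof -
      have "(Y * X) $$ (i, j) = (\<Sum>k<?n. (if k = i then (if i \<in> ?L then ?y else 1) * X $$ (i, j) else 0)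
          + (if k \<in> ?L then if i \<notin> ?L then ?a i k * X $$ (k, j) else 0 else 0))"
        unfolding mat_mult_index_sum[OF Y X i j]
        by (rule sum.cong) (use i in \<open>auto simp: Y_def\<close>)
      then show ?thesis
        using i sumsub[of "\<lambda>_. True" "\<lambda>k. ?a i k * X $$ (k, j)"] by (cases "i \<in> ?L") (simp_all add: sum.distrib cong: if_cong)
    qed
    have Xl: "X $$ (k, j) = (if k = j then 1 else 0)" if "k \<in> ?L" for k
      using that j by (auto simp: X_def core_mat_def leaves_def verts_def)
    have Lj: "(\<Sum>k\<in>?L. ?a i k * X $$ (k, j)) = (if j \<in> ?L then ?a i j else 0)"
    proof -
      have "(\<Sum>k\<in>?L. ?a i k * X $$ (k, j)) = (\<Sum>k\<in>?L. if k = j then ?a i j else 0)"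
        by (rule sum.cong) (auto simp: Xl)
      then show ?thesis by simp
    qed
    show "(?M * T) $$ (i, j) = (Y * X) $$ (i, j)"
    proof (cases "i \<in> ?L")
      case iL: True
      then have d1: "degree G i = 1" by (simp add: leaves_def)
      \<comment> \<open>Leaves are pairwise nonadjacent, so in a leaf row only the diagonal entry
        \<open>x - 1\<close> is subtracted; it cancels the adjacency scaled by
        \<open>x - 1\<close>.\<close>
      have "(\<Sum>k\<in>{k \<in> ?L. adj G k j}. ?M $$ (i, k)) = (if adj G i j then ?y else 0)"
      proof -
        have "(\<Sum>k\<in>{k \<in> ?L. adj G k j}. ?M $$ (i, k)) = (\<Sum>k\<in>{k \<in> ?L. adj G k j}. if k = i then ?y else 0)"
          by (rule sum.cong) (use nll[OF iL] i d1 in \<open>auto simp: Mij leaves_def verts_def one_pCons\<close>)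
        then show ?thesis using iL by simp
      qed
      moreover have "j \<in> ?S" if "adj G i j"
      proof -
        have "i \<in> pendants G j" using that iL wf by (simp add: pendants_def mem_nbrs adj_commute)
        then show ?thesis using adj_verts[OF wf that] by (auto simp: supports_def)
      qed
      ultimately show ?thesis
        unfolding lhs rhs Xl[OF iL] using iL i j d1 disj by (auto simp: Mij one_pCons)
    next
      case iL: False
      \<comment> \<open>The sum counts leaves adjacent to both \<open>i\<close> and
        \<open>j\<close>; a leaf has a single neighbour, so only \<open>i = j\<close>
        contributes.\<close>
      have "(\<Sum>k\<in>{k \<in> ?L. adj G k j}. ?M $$ (i, k)) = (if i = j then of_nat (card (pendants G i)) else 0)"
      proof -
        have "(\<Sum>k\<in>{k \<in> ?L. adj G k j}. ?M $$ (i, k)) = (\<Sum>k\<in>{k \<in> ?L. adj G k j}. if i = j then 1 else 0)"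
        proof (rule sum.cong[OF refl])
          fix k assume k: "k \<in> {k \<in> ?L. adj G k j}"
          have "adj G i k \<longleftrightarrow> i = j" using leaf_nbr_unique[OF wf, of k j i] k by (auto simp: adj_commute)
          then show "?M $$ (i, k) = (if i = j then 1 else 0)"
            using k iL i by (auto simp: Mij leaves_def verts_def)
        qed
        moreover have "{k \<in> ?L. adj G k j} = pendants G j"
          using wf by (auto simp: pendants_def mem_nbrs adj_commute)
        ultimately show ?thesis by simp
      qed
      moreover have Xij: "X $$ (i, j) = (if j \<in> ?L then 0 else ((if i = j then ?x - of_nat (degree G i) else 0) + ?a i j)
          * (if j \<in> ?S then ?x - 1 else 1) - (if i = j then of_nat (card (pendants G i)) else 0))"
        using iL i j by (simp add: X_def core_mat_def)
      moreover have "card (pendants G i) = 0" if "i \<notin> ?S"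
        using that i by (auto simp: supports_def verts_def)
      ultimately show ?thesis
        unfolding lhs rhs Lj Xij using iL i j jN by (auto simp: Mij y)
    qed
  qed (simp_all only: index_mult_mat carrier_matD[OF M] carrier_matD[OF T] carrier_matD[OF X] carrier_matD[OF Y])
  then have "det ?M * det T = det Y * det X"
    using det_mult[OF M T] det_mult[OF Y X] by simp
  moreover have "det T = ?y ^ card ?S"
  proof -
    have "det T = (\<Prod>i<?n. T $$ (i, i))"
      by (rule det_ranked[OF T, where rk = "\<lambda>i. if i \<in> ?L then 0 else 1"])
        (use disj in \<open>auto simp: T_def split: if_splits\<close>)
    also have "\<dots> = (\<Prod>i<?n. if i \<in> ?S then ?y else 1)" by (rule prod.cong) (auto simp: T_def)
    also have "\<dots> = (\<Prod>i\<in>{i \<in> {..<?n}. i \<in> ?S}. ?y)" by (rule prod.inter_filter[symmetric]) simp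
    also have "{i \<in> {..<?n}. i \<in> ?S} = ?S" by (auto simp: supports_def verts_def)
    finally show ?thesis by simp
  qed
  moreover have "det Y = ?y ^ card ?L"
  proof -
    have "det Y = (\<Prod>i<?n. Y $$ (i, i))"
      by (rule det_ranked[OF Y, where rk = "\<lambda>i. if i \<in> ?L then 1 else 0"])
        (auto simp: Y_def split: if_splits)
    also have "\<dots> = (\<Prod>i<?n. if i \<in> ?L then ?y else 1)" by (rule prod.cong) (auto simp: Y_def)
    also have "\<dots> = (\<Prod>i\<in>{i \<in> {..<?n}. i \<in> ?L}. ?y)" by (rule prod.inter_filter[symmetric]) simp
    also have "{i \<in> {..<?n}. i \<in> ?L} = ?L" by (auto simp: leaves_def verts_def)
    finally show ?thesis by simp
  qed
  ultimately show ?thesis unfolding char_poly_def X_def by simp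
qed

text \<open>Evaluation is a ring homomorphism and commutes with the determinant. This allows
  \<open>x = 1\<close> to be inserted after the powers of \<open>x - 1\<close> have been
  cancelled.\<close>

lemma poly_det_core_mat: "poly (det (core_mat G [:0, 1:])) (x::real) = det (core_mat G x)"
proof -
  have hom: "comm_ring_hom (\<lambda>p::real poly. poly p x)" by unfold_locales auto
  have "map_mat (\<lambda>p. poly p x) (core_mat G [:0, 1:]) = core_mat G x"
    by (rule eq_matI) (auto simp: core_mat_def)
  moreover have "poly (det (core_mat G [:0, 1:])) x = det (map_mat (\<lambda>p. poly p x) (core_mat G [:0, 1:]))"
    by (rule comm_ring_hom.hom_det[OF hom, symmetric])
  ultimately show ?thesis by simp
qed

text \<open>At \<open>x = 1\<close> the factor \<open>x - 1\<close> erases every support column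
  except for its leaf count on the diagonal, so the matrix is diagonal.\<close>

lemma det_core_mat_1_full:
  assumes "supports G \<union> leaves G = verts G" and "supports G \<inter> leaves G = {}"
  shows "det (core_mat G (1::real)) = (\<Prod>v\<in>supports G. - real (card (pendants G v)))"
proof -
  let ?n = "fst G" let ?A = "core_mat G (1::real)"
  have A: "?A \<in> carrier_mat ?n ?n" by (simp add: core_mat_def)
  have sup: "i \<in> supports G" if "i < ?n" "i \<notin> leaves G" for i
    using assms(1) that by (auto simp: verts_def)
  have "det ?A = (\<Prod>i<?n. ?A $$ (i, i))"
    by (rule det_ranked[OF A, where rk = "\<lambda>_. 0"]) (auto simp: core_mat_def sup)
  also have "\<dots> = (\<Prod>i<?n. if i \<in> supports G then - real (card (pendants G i)) else 1)"
    by (rule prod.cong) (use assms(2) in \<open>auto simp: core_mat_def sup\<close>)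
  also have "\<dots> = (\<Prod>i\<in>{i \<in> {..<?n}. i \<in> supports G}. - real (card (pendants G i)))"
    by (rule prod.inter_filter[symmetric]) simp
  also have "{i \<in> {..<?n}. i \<in> supports G} = supports G" by (auto simp: supports_def verts_def)
  finally show ?thesis .
qed

text \<open>Only the principal submatrix of \<open>1 - L\<close> on \<open>w\<^sub>1, w\<^sub>2\<close> matters; its determinant is
  \<open>(d\<^sub>1 - 1) (d\<^sub>2 - 1) - a \<ge> 0\<close>, where \<open>a \<le> 1\<close>.\<close>

lemma det_core_mat_1_two:
  assumes wf: "wf_graph G" and disj: "supports G \<inter> leaves G = {}"
    and w: "verts G - supports G - leaves G = {w1, w2}" "w1 \<noteq> w2"
    and pos: "\<And>v. v \<in> verts G \<Longrightarrow> degree G v > 0"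
  shows "0 \<le> (\<Prod>v\<in>supports G. - real (card (pendants G v))) * det (core_mat G (1::real))"
proof -
  let ?n = "fst G" let ?A = "core_mat G (1::real)" let ?L = "leaves G" and ?S = "supports G"
  define a where "a = (if adj G w1 w2 then 1 else 0 :: real)"
  define d1 d2 where "d1 = real (degree G w1) - 1" and "d2 = real (degree G w2) - 1"
  define P where "P = (\<Prod>v\<in>?S. - real (card (pendants G v)))"
  have wn: "w1 < ?n" "w2 < ?n" and wL: "w1 \<notin> ?L" "w2 \<notin> ?L" and wS: "w1 \<notin> ?S" "w2 \<notin> ?S"
  proof -
    have "w1 \<in> verts G - ?S - ?L" "w2 \<in> verts G - ?S - ?L" using w(1) by simp_all
    then show "w1 < ?n" "w2 < ?n" "w1 \<notin> ?L" "w2 \<notin> ?L" "w1 \<notin> ?S" "w2 \<notin> ?S"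
      by (simp_all add: verts_def)
  qed
  have trichotomy: "i \<in> ?L \<or> i \<in> ?S \<or> i = w1 \<or> i = w2" if "i < ?n" for i
  proof -
    have "i \<in> verts G" using that by (simp add: verts_def)
    then show ?thesis using w(1) by blast
  qed
  have "degree G w1 \<ge> 2" "degree G w2 \<ge> 2"
    using pos[of w1] pos[of w2] wn wL by (auto simp: leaves_def verts_def)
  then have d: "d1 \<ge> 1" "d2 \<ge> 1" by (auto simp: d1_def d2_def)
  \<comment> \<open>The column operation replaces column \<open>w2\<close> by \<open>d1\<close>
    times itself plus \<open>a\<close> times column \<open>w1\<close>. This clears the entry in row
    \<open>w1\<close>, since the two diagonal entries are \<open>- d1\<close> and
    \<open>- d2\<close> and both off-diagonal ones are \<open>a\<close>.\<close>
  define V where "V = mat ?n ?n (\<lambda>(i, j). if j = w2 then if i = w2 then d1 else if i = w1 then a else 0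
    else if i = j then 1 else 0)"
  have A: "?A \<in> carrier_mat ?n ?n" and V: "V \<in> carrier_mat ?n ?n" by (simp_all add: core_mat_def V_def)
  have AV: "(?A * V) $$ (i, j) = (if j = w2 then ?A $$ (i, w2) * d1 + ?A $$ (i, w1) * a else ?A $$ (i, j))"
    if "i < ?n" "j < ?n" for i j
  proof -
    have "(?A * V) $$ (i, j) = (\<Sum>k<?n. if j = w2
        then (if k = w2 then ?A $$ (i, w2) * d1 else 0) + (if k = w1 then ?A $$ (i, w1) * a else 0)
        else (if k = j then ?A $$ (i, j) else 0))"
      unfolding mat_mult_index_sum[OF A V that]
      by (rule sum.cong) (use that w(2) in \<open>auto simp: V_def\<close>)
    then show ?thesis using that wn by (simp add: sum.distrib)
  qed
  have b0: "card (pendants G w1) = 0" "card (pendants G w2) = 0"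
    using wS wn by (auto simp: supports_def verts_def)
  have irr: "\<not> adj G u u" for u by (rule adj_irrefl[OF wf])
  have Aw: "?A $$ (w1, w1) = - d1" "?A $$ (w2, w2) = - d2" "?A $$ (w1, w2) = a" "?A $$ (w2, w1) = a"
    using wn wL wS w(2) b0 irr by (auto simp: core_mat_def d1_def d2_def a_def adj_commute)
  have Ai: "?A $$ (i, j) = (if i = j then if i \<in> ?L then 1 else - real (card (pendants G i)) else 0)"
    if "i < ?n" "j < ?n" "i \<in> ?L \<or> j \<in> ?L \<or> j \<in> ?S" for i j
    using that disj by (auto simp: core_mat_def)
  have detV: "det V = d1"
  proof -
    have "det V = (\<Prod>i<?n. V $$ (i, i))"
      by (rule det_ranked[OF V, where rk = "\<lambda>i. if i = w2 then 1 else 0"])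
        (auto simp: V_def split: if_splits)
    also have "\<dots> = (\<Prod>i<?n. if i = w2 then d1 else 1)" by (rule prod.cong) (auto simp: V_def)
    finally show ?thesis using wn by simp
  qed
  have carr: "?A * V \<in> carrier_mat ?n ?n" using A V by simp
  have "det (?A * V) = (\<Prod>i<?n. (?A * V) $$ (i, i))"
  proof (rule det_ranked[OF carr, where rk = "\<lambda>i. if i = w1 then 2 else if i = w2 then 1 else 0"])
    fix i j assume ij: "i < ?n" "j < ?n" "i \<noteq> j"
      and rk: "(if j = w1 then 2 else if j = w2 then 1 else 0::nat) \<le> (if i = w1 then 2 else if i = w2 then 1 else 0)"
    show "(?A * V) $$ (i, j) = 0"
    proof (cases "j \<in> ?L \<or> j \<in> ?S \<or> i \<in> ?L")
      case True
      then show ?thesis using ij wL wS wn w(2) by (auto simp: AV Ai)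
    next
      case False
      then have "j = w1 \<or> j = w2" using trichotomy[OF ij(2)] by auto
      then have "i = w1 \<and> j = w2" using rk ij(3) by (auto split: if_splits)
      then show ?thesis using Aw ij by (simp add: AV)
    qed
  qed
  also have "\<dots> = (\<Prod>i<?n. (if i = w1 then - d1 else 1) * ((if i = w2 then a * a - d1 * d2 else 1) *
      (if i \<in> ?S then - real (card (pendants G i)) else 1)))"
  proof (rule prod.cong[OF refl])
    fix i assume "i \<in> {..<?n}"
    then have i: "i < ?n" by simp
    show "(?A * V) $$ (i, i) = (if i = w1 then - d1 else 1) * ((if i = w2 then a * a - d1 * d2 else 1) *
      (if i \<in> ?S then - real (card (pendants G i)) else 1))"
      using trichotomy[OF i] i wL wS w(2) disj Ai[of i i] by (auto simp: AV Aw)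
  qed
  also have "\<dots> = - d1 * ((a * a - d1 * d2) * (\<Prod>i<?n. if i \<in> ?S then - real (card (pendants G i)) else 1))"
    using wn by (simp add: prod.distrib)
  also have "(\<Prod>i<?n. if i \<in> ?S then - real (card (pendants G i)) else 1) = P"
  proof -
    have "{i \<in> {..<?n}. i \<in> ?S} = ?S" by (auto simp: supports_def verts_def)
    then show ?thesis
      using prod.inter_filter[of "{..<?n}" "\<lambda>i. - real (card (pendants G i))" "\<lambda>i. i \<in> ?S"]
      unfolding P_def by simp
  qed
  finally have "det ?A * d1 = (d1 * d2 - a * a) * P * d1"
    unfolding det_mult[OF A V] detV by (simp add: algebra_simps)
  then have "det ?A = (d1 * d2 - a * a) * P" using d by simp
  then have "P * det ?A = (d1 * d2 - a * a) * (P * P)" by (simp add: ac_simps)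
  moreover have "d1 * d2 \<ge> 1 * 1" using d by (intro mult_mono) auto
  then have "0 \<le> d1 * d2 - a * a" by (auto simp: a_def)
  then have "0 \<le> (d1 * d2 - a * a) * (P * P)" by (rule mult_nonneg_nonneg) simp
  ultimately show ?thesis unfolding P_def[symmetric] by (simp only:)
qed

section \<open>The leaves of a cospectral graph\<close>

text \<open>The ratios \<open>r = b v / p\<close> have sum \<open>card S\<close> and product 1, so
  the nonnegative terms \<open>r - 1 - ln r\<close> add up to 0; each of them vanishes only at
  \<open>r = 1\<close>.\<close>

lemma am_gm_equality:
  fixes b :: "'a \<Rightarrow> nat"
  assumes "finite S" and pos: "\<And>v. v \<in> S \<Longrightarrow> b v > 0" and p: "p > 0"
    and sum: "(\<Sum>v\<in>S. b v) = p * card S" and prod: "(\<Prod>v\<in>S. b v) = p ^ card S"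
    and v: "v \<in> S"
  shows "b v = p"
proof -
  let ?r = "\<lambda>v. real (b v) / real p"
  have nn: "?r v - 1 - ln (?r v) \<ge> 0" if "v \<in> S" for v
    using ln_le_minus_one[of "?r v"] pos[OF that] p by simp
  have "(\<Sum>v\<in>S. ln (?r v)) = ln (\<Prod>v\<in>S. ?r v)"
    using pos p by (intro ln_prod[symmetric] assms(1)) auto
  also have "(\<Prod>v\<in>S. ?r v) = 1"
    using prod p by (simp add: prod_dividef flip: of_nat_prod)
  finally have "(\<Sum>v\<in>S. ln (?r v)) = 0" by simp
  moreover have "(\<Sum>v\<in>S. ?r v - 1) = 0"
    using sum p by (simp add: sum_subtractf flip: sum_divide_distrib of_nat_sum)
  ultimately have "(\<Sum>v\<in>S. ?r v - 1 - ln (?r v)) = 0" by (simp add: sum_subtractf)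
  then have "?r v - 1 - ln (?r v) = 0"
    using sum_nonneg_eq_0_iff[OF assms(1), of "\<lambda>v. ?r v - 1 - ln (?r v)"] nn v by blast
  then have "?r v = 1" using ln_eq_minus_one[of "?r v"] pos[OF v] p by simp
  then show ?thesis using p by simp
qed

section \<open>Leaf elimination for the jellyfish graph\<close>

lemma leaves_jfg:
  assumes "q \<ge> 3"
  shows "leaves (jfg p q) = {q..<q + q * p}"
proof (rule Set.set_eqI)
  fix v
  show "v \<in> leaves (jfg p q) \<longleftrightarrow> v \<in> {q..<q + q * p}"
  proof (cases "v \<in> verts (jfg p q)")
    case True
    then show ?thesis
    proof (cases rule: verts_jfg_cases)
      case 1
      then show ?thesis using degree_jfg_cycle[OF 1 assms, of p] by (simp add: leaves_def)
    next
      case (2 i j)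
      then show ?thesis
        using degree_jfg_pendant[OF 2(1,2)] pendant_index_less[OF 2(1,2)] by (simp add: leaves_def verts_def)
    qed
  qed (auto simp: leaves_def verts_def)
qed

lemma pendants_jfg:
  assumes "q \<ge> 3" and "i < q"
  shows "pendants (jfg p q) i = (\<lambda>j. q + i * p + j) ` {..<p}"
proof -
  have "{cyc_succ q i, if i = 0 then q - 1 else i - 1} \<subseteq> {..<q}"
    using assms by (auto intro: mod_less_divisor)
  moreover have "(\<lambda>j. q + i * p + j) ` {..<p} \<subseteq> {q..<q + q * p}"
    using pendant_index_less[OF assms(2)] by auto
  ultimately show ?thesis
    unfolding pendants_def nbrs_jfg_cycle[OF assms(2)] leaves_jfg[OF assms(1)] by fastforce
qed

lemma supports_jfg:
  assumes "q \<ge> 3" and "p \<ge> 1"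
  shows "supports (jfg p q) = {..<q}"
proof (rule Set.set_eqI)
  fix v
  show "v \<in> supports (jfg p q) \<longleftrightarrow> v \<in> {..<q}"
  proof (cases "v < q")
    case True
    then show ?thesis using assms by (simp add: supports_def pendants_jfg verts_def lessThan_empty_iff)
  next
    case False
    have "supports (jfg p q) \<inter> leaves (jfg p q) = {}"
      by (rule sum_pendants(2)) (use assms wf_jfg connected_jfg in auto)
    then show ?thesis using False by (auto simp: leaves_jfg[OF assms(1)] supports_def verts_def)
  qed
qed

lemma det_core_mat_jfg:
  assumes "q \<ge> 3" and "p \<ge> 1"
  shows "det (core_mat (jfg p q) (1::real)) = (- real p) ^ q"
proof -
  have "det (core_mat (jfg p q) (1::real)) =
      (\<Prod>v\<in>supports (jfg p q). - real (card (pendants (jfg p q) v)))"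
    by (rule det_core_mat_1_full) (auto simp: supports_jfg[OF assms] leaves_jfg[OF assms(1)] verts_def)
  also have "\<dots> = (\<Prod>v<q. - real p)"
    using assms by (intro prod.cong) (auto simp: supports_jfg pendants_jfg card_image inj_on_def)
  finally show ?thesis by simp
qed

lemma jfg_elimination:
  assumes "q \<ge> 3" and "p \<ge> 1"
  shows "char_poly (laplacian (jfg p q)) * [:-1, 1:] ^ q =
    [:-1, 1:] ^ (q * p) * det (core_mat (jfg p q) [:0, 1:])"
  using char_poly_leaf_elimination[of "jfg p q"] assms wf_jfg connected_jfg
  by (simp add: supports_jfg leaves_jfg)

text \<open>After cancelling \<open>m\<close> factors, any factor left on the right would make
  \<open>a\<close> a root of \<open>f\<close>. With \<open>f\<close> the jellyfish core determinant
  this pins down the number of support vertices.\<close>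

lemma linear_power_cancel:
  fixes f g :: "'a::idom poly"
  assumes eq: "[:-a, 1:] ^ m * f = [:-a, 1:] ^ k * g" and f: "poly f a \<noteq> 0" and "m \<le> k"
  shows "m = k \<and> f = g"
proof -
  have "[:-a, 1:] ^ m * f = [:-a, 1:] ^ m * ([:-a, 1:] ^ (k - m) * g)"
    using eq \<open>m \<le> k\<close> by (simp add: mult.assoc[symmetric] power_add[symmetric])
  then have fg: "f = [:-a, 1:] ^ (k - m) * g" by (simp add: pCons_eq_0_iff)
  have "k - m = 0"
  proof (rule ccontr)
    assume "k - m \<noteq> 0"
    then have "poly f a = 0" unfolding fg by simp
    with f show False by simp
  qed
  with fg \<open>m \<le> k\<close> show ?thesis by simp
qed

text \<open>In the exceptional degree sequence of \<open>cospectral_jfg_degrees_or_exception\<close> the determinants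
  \<open>det (1 - L)\<close> of the two graphs would have different signs.\<close>

lemma cospectral_jfg_degrees:
  assumes p: "p \<ge> 1" and q: "q \<ge> 4" and wf: "wf_graph H" and co: "L_cospectral H (jfg p q)"
  shows "\<forall>v\<in>verts H. degree H v = 1 \<or> degree H v = p + 2"
proof (rule ccontr)
  assume "\<not> ?thesis"
  with cospectral_jfg_degrees_or_exception[OF assms] have p1: "p = 1" and l: "card (leaves H) = q - 1"
    by (auto simp: leaves_def)
  let ?J = "jfg p q" and ?S = "supports H" and ?y = "[:-1, 1:] :: real poly"
  have q3: "q \<ge> 3" and wfJ: "wf_graph ?J" using q wf_jfg by auto
  have con: "connected_graph H"
    by (rule connected_graph_cospectral[OF wfJ wf co connected_jfg[OF q3]])
  have n: "fst H = 2 * q" using L_cospectral_order[OF co] p1 by simp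
  have n3: "fst H \<ge> 3" using n q by simp
  note sp = sum_pendants[OF wf con n3]
  have pos: "card (pendants H v) \<ge> 1" if "v \<in> ?S" for v
    using that by (auto simp: supports_def Suc_le_eq card_gt_0_iff)
  have "card ?S \<le> (\<Sum>v\<in>?S. card (pendants H v))"
    using sum_mono[of ?S "\<lambda>_. 1" "\<lambda>v. card (pendants H v)"] pos by simp
  then have s_le: "card ?S \<le> q - 1" using sp(1) l by simp
  let ?DH = "det (core_mat H [:0, 1:]) :: real poly" and ?DJ = "det (core_mat ?J [:0, 1:]) :: real poly"
  have "char_poly (laplacian H) * ?y ^ q = ?y ^ q * ?DJ"
    using jfg_elimination[OF q3 p] p1 L_cospectral_char_poly[OF co] by simp
  \<comment> \<open>For \<open>p = 1\<close> the jellyfish graph has as many leaves as support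
    vertices, so the powers of \<open>x - 1\<close> cancel completely.\<close>
  then have chi: "char_poly (laplacian H) = ?DJ" by (simp add: mult.commute pCons_eq_0_iff)
  have eqH: "?DJ * ?y ^ card ?S = ?y ^ (q - 1) * ?DH"
    using char_poly_leaf_elimination[OF wf con n3] chi l by simp
  have DJ1: "poly ?DJ 1 = (-1) ^ q"
    unfolding poly_det_core_mat using det_core_mat_jfg[OF q3 p] p1 by simp
  have "?y ^ card ?S * ?DJ = ?y ^ (q - 1) * ?DH" by (rule trans[OF mult.commute eqH])
  from linear_power_cancel[OF this _ s_le] DJ1 have s: "card ?S = q - 1" and DJ: "?DJ = ?DH" by simp_all
  then have "poly ?DH 1 = (-1) ^ q" using DJ DJ1 by simp
  then have DH1: "det (core_mat H (1::real)) = (-1) ^ q" unfolding poly_det_core_mat .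
  have "card (verts H - ?S - leaves H) = 2"
  proof -
    have "card (verts H - (?S \<union> leaves H)) = card (verts H) - card (?S \<union> leaves H)"
      by (rule card_Diff_subset) (auto simp: supports_def leaves_def)
    also have "card (?S \<union> leaves H) = (q - 1) + (q - 1)"
      using sp(2) s l by (simp add: card_Un_disjoint)
    also have "card (verts H) = 2 * q" using n by (simp add: verts_def)
    finally show ?thesis using q by (simp add: Diff_eq Int_assoc)
  qed
  then obtain w1 w2 where w: "verts H - ?S - leaves H = {w1, w2}" "w1 \<noteq> w2"
    by (auto simp: card_2_iff)
  have dpos: "degree H v > 0" if "v \<in> verts H" for v
    by (rule connected_degree_pos[OF wf con that]) (use n3 in \<open>simp add: verts_def\<close>)
  \<comment> \<open>As many leaves as support vertices, and every support vertex has at least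
    one.\<close>
  have one: "card (pendants H v) = 1" if v: "v \<in> ?S" for v
  proof -
    have "(\<Sum>v\<in>?S. card (pendants H v) - 1) = 0"
      using sum_subtractf_nat[of ?S "\<lambda>_. 1" "\<lambda>v. card (pendants H v)"] pos sp(1) s l by simp
    then show ?thesis using pos[OF v] v by (simp add: sum_eq_0_iff) (meson le_antisym)
  qed
  have "(\<Prod>v\<in>?S. - real (card (pendants H v))) = (-1) ^ (q - 1)"
    by (simp add: one s)
  then have "0 \<le> (-1 :: real) ^ (q - 1) * (-1) ^ q"
    using det_core_mat_1_two[OF wf sp(2) w dpos] DH1 by simp
  \<comment> \<open>Exactly one of the consecutive exponents is odd, against the sign given by the 2
    by 2 block.\<close>
  moreover have "(-1 :: real) ^ (q - 1) * (-1) ^ q = -1"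
    using q by (cases q) (simp_all add: power_mult_distrib[symmetric])
  ultimately show False by simp
qed

text \<open>Matching the exponents of \<open>x - 1\<close> shows that there are \<open>q\<close>
  support vertices, as many as non-leaves. So every non-leaf carries a leaf, which makes the core
  matrix at 1 diagonal and all leaf counts positive, as the equality case of AM-GM requires.\<close>

lemma cospectral_jfg_structure:
  assumes p: "p \<ge> 1" and q: "q \<ge> 4" and wf: "wf_graph H" and co: "L_cospectral H (jfg p q)"
  shows "fst H = q + q * p" and "connected_graph H" and "card (supports H) = q"
    and "verts H = supports H \<union> leaves H" and "supports H \<inter> leaves H = {}"
    and "\<And>v. v \<in> supports H \<Longrightarrow> card (pendants H v) = p \<and> card (nbrs H v \<inter> supports H) = 2"
proof -
  let ?J = "jfg p q" and ?S = "supports H" and ?L = "leaves H"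
  have q3: "q \<ge> 3" and wfJ: "wf_graph ?J" using q wf_jfg by auto
  show con: "connected_graph H"
    by (rule connected_graph_cospectral[OF wfJ wf co connected_jfg[OF q3]])
  show n: "fst H = q + q * p" using L_cospectral_order[OF co] by simp
  have n3: "fst H \<ge> 3" using n q by simp
  note deg = cospectral_jfg_degrees[OF assms]
  note sp = sum_pendants[OF wf con n3]
  show disj: "?S \<inter> ?L = {}" by (rule sp(2))
  let ?C = "verts H - ?L"
  have SC: "?S \<subseteq> ?C" using disj by (auto simp: supports_def)
  have LV: "?L \<subseteq> verts H" by (auto simp: leaves_def)
  have V: "verts H = {..<q + q * p}" using n by (auto simp: verts_def)
  have cV: "card ?L + card ?C = q + q * p"
    using card_Diff_subset[OF finite_leaves LV] card_mono[OF finite_verts LV] V by simp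
  have "(\<Sum>v\<in>verts H. degree H v) = (\<Sum>v\<in>?C. degree H v) + (\<Sum>v\<in>?L. degree H v)"
    by (rule sum.subset_diff[OF LV]) simp
  also have "(\<Sum>v\<in>?C. degree H v) = (\<Sum>v\<in>?C. p + 2)"
    by (rule sum.cong) (use deg in \<open>auto simp: leaves_def\<close>)
  also have "(\<Sum>v\<in>?L. degree H v) = (\<Sum>v\<in>?L. 1)"
    by (rule sum.cong) (auto simp: leaves_def)
  finally have "card ?C * (p + 2) + card ?L = (\<Sum>v\<in>verts H. degree H v)" by simp
  moreover have "(\<Sum>v\<in>verts H. degree H v) = 2 * (q + q * p)"
    using cospectral_jfg_degree_sums(2)[OF q wf co] unfolding V of_nat_sum[symmetric] by linarith
  ultimately have "card ?C * (p + 1) = q * (p + 1)" using cV by (simp add: algebra_simps)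
  then have C: "card ?C = q" by (metis add_is_0 mult_cancel2 one_neq_zero)
  then have L: "card ?L = q * p" using cV by simp
  have s_le: "card ?S \<le> q" using card_mono[OF _ SC] C by simp
  let ?y = "[:-1, 1:] :: real poly"
  let ?DH = "det (core_mat H [:0, 1:]) :: real poly" and ?DJ = "det (core_mat ?J [:0, 1:]) :: real poly"
  have DJ1: "poly ?DJ 1 = (- real p) ^ q"
    unfolding poly_det_core_mat by (rule det_core_mat_jfg[OF q3 p])
  have eqH: "char_poly (laplacian ?J) * ?y ^ card ?S = ?y ^ (q * p) * ?DH"
    using char_poly_leaf_elimination[OF wf con n3] L L_cospectral_char_poly[OF co] by simp
  \<comment> \<open>The elimination identities of the two graphs share the characteristic polynomial
    and the number of leaves; combining them removes both.\<close>
  have "?y ^ (q * p) * (?y ^ card ?S * ?DJ) = (?y ^ (q * p) * ?DJ) * ?y ^ card ?S" by (simp only: ac_simps)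
  also have "\<dots> = (char_poly (laplacian ?J) * ?y ^ card ?S) * ?y ^ q"
    unfolding jfg_elimination[OF q3 p, symmetric] by (simp only: ac_simps)
  also have "\<dots> = ?y ^ (q * p) * (?y ^ q * ?DH)" unfolding eqH by (simp only: ac_simps)
  finally have "?y ^ card ?S * ?DJ = ?y ^ q * ?DH" by (simp add: pCons_eq_0_iff)
  from linear_power_cancel[OF this _ s_le] DJ1 p have s': "card ?S = q" and DJ: "?DJ = ?DH" by simp_all
  show s: "card ?S = q" by (rule s')
  have S: "?S = ?C" by (rule card_subset_eq[OF _ SC]) (use s C in simp_all)
  then show VS: "verts H = ?S \<union> ?L" using LV by blast
  have "det (core_mat H (1::real)) = (- real p) ^ q"
    using DJ DJ1 s by (simp add: poly_det_core_mat)
  moreover have "det (core_mat H (1::real)) = (\<Prod>v\<in>?S. - real (card (pendants H v)))"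
    by (rule det_core_mat_1_full) (use VS disj in auto)
  ultimately have "(\<Prod>v\<in>?S. - real (card (pendants H v))) = (- real p) ^ q" by simp
  \<comment> \<open>Absolute values discard the signs and turn the identity into one between natural
    numbers.\<close>
  then have "\<bar>\<Prod>v\<in>?S. - real (card (pendants H v))\<bar> = \<bar>(- real p) ^ q\<bar>" by simp
  then have "real (\<Prod>v\<in>?S. card (pendants H v)) = real (p ^ q)"
    by (simp add: abs_prod power_abs)
  then have prod: "(\<Prod>v\<in>?S. card (pendants H v)) = p ^ card ?S" unfolding s by (simp only: of_nat_eq_iff)
  show "card (pendants H v) = p \<and> card (nbrs H v \<inter> supports H) = 2" if v: "v \<in> ?S" for v
  proof
    show P: "card (pendants H v) = p"
      by (rule am_gm_equality[OF finite_supports _ _ _ prod v])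
        (use p sp(1) L s in \<open>auto simp: supports_def card_gt_0_iff mult.commute\<close>)
    have "card (nbrs H v) = p + 2"
      using deg v disj by (auto simp: degree_eq_card_nbrs[symmetric] leaves_def supports_def)
    moreover have "nbrs H v = pendants H v \<union> (nbrs H v \<inter> ?S)"
      using VS by (auto simp: pendants_def nbrs_def)
    moreover have "card (pendants H v \<union> (nbrs H v \<inter> ?S)) = card (pendants H v) + card (nbrs H v \<inter> ?S)"
      by (rule card_Un_disjoint) (use disj in \<open>auto simp: pendants_def\<close>)
    ultimately show "card (nbrs H v \<inter> ?S) = 2" using P by simp
  qed
qed

section \<open>Reconstruction of the graph\<close>

text \<open>A walk that never turns back exists because each vertex has a neighbour different from
  the previous one. The choice runs over pairs of current and next vertex, so that the previous
  vertex is still at hand.\<close>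

lemma two_regular_walk:
  assumes two: "\<And>v. v \<in> C \<Longrightarrow> N v \<subseteq> C \<and> card (N v) = 2" and ne: "C \<noteq> {}"
  obtains s :: "nat \<Rightarrow> 'a" where "\<And>n. s n \<in> C" and "\<And>n. s (Suc n) \<in> N (s n)" and "\<And>n. s (Suc (Suc n)) \<noteq> s n"
proof -
  have other: "\<exists>x. x \<in> N w \<and> x \<noteq> u" if "w \<in> C" for u w
  proof (rule ccontr)
    assume "\<nexists>x. x \<in> N w \<and> x \<noteq> u"
    then have "N w \<subseteq> {u}" by blast
    from card_mono[OF _ this] two[OF that] show False by simp
  qed
  have "\<exists>f. \<forall>n. (fst (f n) \<in> C \<and> snd (f n) \<in> N (fst (f n))) \<and>
      (fst (f (Suc n)) = snd (f n) \<and> snd (f (Suc n)) \<noteq> fst (f n))"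
  proof (rule dependent_nat_choice)
    from ne obtain v where v: "v \<in> C" by blast
    with other[of v v] obtain x where "x \<in> N v" by blast
    with v show "\<exists>x. fst x \<in> C \<and> snd x \<in> N (fst x)" by (intro exI[of _ "(v, x)"]) simp
  next
    fix x :: "'a \<times> 'a" and n :: nat
    assume x: "fst x \<in> C \<and> snd x \<in> N (fst x)"
    then have "snd x \<in> C" using two by blast
    with other[of "snd x" "fst x"] obtain z where "z \<in> N (snd x)" "z \<noteq> fst x" by blast
    then show "\<exists>y. (fst y \<in> C \<and> snd y \<in> N (fst y)) \<and> fst y = snd x \<and> snd y \<noteq> fst x"
      using \<open>snd x \<in> C\<close> by (intro exI[of _ "(snd x, z)"]) simp
  qed
  then obtain f where f: "\<And>n. fst (f n) \<in> C" "\<And>n. snd (f n) \<in> N (fst (f n))"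
    "\<And>n. fst (f (Suc n)) = snd (f n)" "\<And>n. snd (f (Suc n)) \<noteq> fst (f n)" by blast
  show thesis
  proof (rule that[of "\<lambda>n. fst (f n)"])
    fix n
    show "fst (f n) \<in> C" by (rule f(1))
    show "fst (f (Suc n)) \<in> N (fst (f n))" using f(2)[of n] f(3)[of n] by simp
    show "fst (f (Suc (Suc n))) \<noteq> fst (f n)" using f(3)[of "Suc n"] f(4)[of n] by simp
  qed
qed

text \<open>The walk repeats itself in a finite set, and the first repetition must return to the
  start. The vertices visited until then are closed under taking neighbours, so connectedness makes
  them all of \<open>C\<close>.\<close>

lemma two_regular_connected_cycle:
  assumes fin: "finite C" and ne: "C \<noteq> {}"
    and two: "\<And>v. v \<in> C \<Longrightarrow> N v \<subseteq> C \<and> card (N v) = 2"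
    and sym: "\<And>u v. u \<in> C \<Longrightarrow> v \<in> N u \<Longrightarrow> u \<in> N v" and irr: "\<And>v. v \<notin> N v"
    and con: "\<And>S. S \<subseteq> C \<Longrightarrow> S \<noteq> {} \<Longrightarrow> S \<noteq> C \<Longrightarrow> \<exists>u\<in>S. \<exists>v\<in>C - S. v \<in> N u"
  obtains c where "bij_betw c {..<card C} C"
    and "\<And>i. i < card C \<Longrightarrow> N (c i) = {c (cyc_succ (card C) i), c (if i = 0 then card C - 1 else i - 1)}"
proof -
  obtain s where sC: "\<And>n. s n \<in> C" and step: "\<And>n. s (Suc n) \<in> N (s n)" and ns: "\<And>n. s (Suc (Suc n)) \<noteq> s n"
  proof (rule two_regular_walk[of C N])
    show "N v \<subseteq> C \<and> card (N v) = 2" if "v \<in> C" for v by (rule two[OF that])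
    show "C \<noteq> {}" by (rule ne)
  qed (rule that)
  have step': "s n \<in> N (s (Suc n))" for n using sym[OF sC step] .
  have pair: "N w = {x, y}" if "w \<in> C" "x \<in> N w" "y \<in> N w" "x \<noteq> y" for w x y
  proof -
    have "finite (N w)" using two[OF that(1)] fin finite_subset by blast
    moreover have "{x, y} \<subseteq> N w" using that by simp
    moreover have "card {x, y} = card (N w)" using two[OF that(1)] that(4) by simp
    ultimately show ?thesis using card_subset_eq by metis
  qed
  have N_Suc: "N (s (Suc n)) = {s n, s (Suc (Suc n))}" for n
    using pair[OF sC step' step] ns[of n] by metis
  have "\<not> inj s"
    using fin sC by (metis finite_imageD finite_subset image_subset_iff infinite_UNIV_nat)
  then have ex: "\<exists>j. \<exists>i<j. s i = s j"
    unfolding inj_def by (metis linorder_neqE_nat)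
  define j where "j = (LEAST j. \<exists>i<j. s i = s j)"
  have "\<exists>i<j. s i = s j" unfolding j_def by (rule LeastI_ex[OF ex])
  then obtain i where i: "i < j" "s i = s j" by blast
  have inj: "k = l" if "k < j" "l < j" "s k = s l" for k l
  proof (rule ccontr)
    assume "k \<noteq> l"
    then have "min k l < max k l" "s (min k l) = s (max k l)" using that(3) by (auto simp: min_def max_def)
    then have "\<exists>i<max k l. s i = s (max k l)" by blast
    then have "j \<le> max k l" unfolding j_def by (rule Least_le)
    with that show False by simp
  qed
  obtain m where m: "j = Suc m" using i(1) by (cases j) auto
  have prev: "s m \<in> N (s i)" using step'[of m] i(2) m by simp
  \<comment> \<open>A later vertex \<open>s i\<close> already has both neighbours on the walk, so
    the predecessor \<open>s m\<close> of the repetition would be one of them; this contradicts the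
    minimality of \<open>j\<close>, the absence of loops or the ban on turning back.\<close>
  have "i = 0"
  proof (rule ccontr)
    assume "i \<noteq> 0"
    then obtain i' where i': "i = Suc i'" by (cases i) auto
    have "s m = s i' \<or> s m = s (Suc i)" using prev N_Suc[of i'] i' by auto
    then show False
    proof
      assume "s m = s i'"
      then have "m = i'" using inj[of m i'] m i(1) i' by simp
      then show False using m i(1) i' by simp
    next
      assume e: "s m = s (Suc i)"
      show False
      proof (cases "Suc i = j")
        case True
        then have "s (Suc i) = s i" using i(2) by simp
        then show False using step[of i] irr by metis
      next
        case False
        then have "m = Suc i" using inj[of m "Suc i"] e m i(1) by simp
        then show False using ns[of i] i(2) m by simp
      qed
    qed
  qed
  with i have s0: "s j = s 0" by simp
  have j3: "j \<ge> 3"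
  proof (rule ccontr)
    assume "\<not> j \<ge> 3"
    then have "j = 1 \<or> j = 2" using m by auto
    then show False
    proof
      assume "j = 1"
      then show False using step[of 0] s0 irr by (metis One_nat_def)
    next
      assume "j = 2"
      then show False using ns[of 0] s0 by (simp add: numeral_2_eq_2)
    qed
  qed
  have N0: "N (s 0) = {s 1, s (j - 1)}"
  proof (rule pair)
    show "s 1 \<in> N (s 0)" using step[of 0] by simp
    show "s (j - 1) \<in> N (s 0)" using prev \<open>i = 0\<close> m by simp
    show "s 1 \<noteq> s (j - 1)" using inj[of 1 "j - 1"] j3 by auto
  qed (rule sC)
  have Ns: "N (s k) = {s (cyc_succ j k), s (if k = 0 then j - 1 else k - 1)}" if "k < j" for k
  proof (cases k)
    case 0
    then show ?thesis using N0 j3 by simp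
  next
    case (Suc k')
    have "s (Suc k) = s (cyc_succ j k)"
      using that s0 by (cases "Suc k = j") simp_all
    then show ?thesis using N_Suc[of k'] Suc by auto
  qed
  have closed: "v \<in> s ` {..<j}" if "k < j" "v \<in> N (s k)" for k v
  proof -
    have "cyc_succ j k < j" "(if k = 0 then j - 1 else k - 1) < j" using that(1) by auto
    then show ?thesis using that(2) unfolding Ns[OF that(1)] by blast
  qed
  have "s ` {..<j} = C"
  proof (rule ccontr)
    assume neq: "s ` {..<j} \<noteq> C"
    have sub: "s ` {..<j} \<subseteq> C" using sC by blast
    have nonempty: "s ` {..<j} \<noteq> {}" using j3 by (auto simp: lessThan_empty_iff)
    from con[OF sub nonempty neq] obtain k v where "k < j" "v \<in> C - s ` {..<j}" "v \<in> N (s k)" by auto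
    with closed show False by blast
  qed
  moreover have "inj_on s {..<j}" using inj by (auto simp: inj_on_def)
  ultimately have bij: "bij_betw s {..<j} C" by (simp add: bij_betw_def)
  then have "card C = j" using bij_betw_same_card by fastforce
  show thesis
    by (rule that[of s]) (use bij Ns \<open>card C = j\<close> in simp_all)
qed

section \<open>Assembling the isomorphism\<close>

lemma graph_iso_sym:
  assumes "graph_iso G H"
  shows "graph_iso H G"
proof -
  obtain f where f: "bij_betw f (verts G) (verts H)"
    "\<And>u v. u \<in> verts G \<Longrightarrow> v \<in> verts G \<Longrightarrow> adj G u v \<longleftrightarrow> adj H (f u) (f v)"
    using assms unfolding graph_iso_def by blast
  let ?g = "inv_into (verts G) f"
  have g: "?g u \<in> verts G" "f (?g u) = u" if "u \<in> verts H" for u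
    using f(1) that by (auto simp: bij_betw_def inv_into_into f_inv_into_f)
  have "adj H u v \<longleftrightarrow> adj G (?g u) (?g v)" if "u \<in> verts H" "v \<in> verts H" for u v
    using f(2)[OF g(1)[OF that(1)] g(1)[OF that(2)]] g(2) that by simp
  then show ?thesis unfolding graph_iso_def using bij_betw_inv_into[OF f(1)] by blast
qed

lemma graph_iso_trans:
  assumes "graph_iso G H" and "graph_iso H K"
  shows "graph_iso G K"
proof -
  obtain f where f: "bij_betw f (verts G) (verts H)"
    "\<And>u v. u \<in> verts G \<Longrightarrow> v \<in> verts G \<Longrightarrow> adj G u v \<longleftrightarrow> adj H (f u) (f v)"
    using assms(1) unfolding graph_iso_def by blast
  obtain g where g: "bij_betw g (verts H) (verts K)"
    "\<And>u v. u \<in> verts H \<Longrightarrow> v \<in> verts H \<Longrightarrow> adj H u v \<longleftrightarrow> adj K (g u) (g v)"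
    using assms(2) unfolding graph_iso_def by blast
  have "f u \<in> verts H" if "u \<in> verts G" for u using f(1) that by (auto simp: bij_betw_def)
  then have "adj G u v \<longleftrightarrow> adj K ((g \<circ> f) u) ((g \<circ> f) v)" if "u \<in> verts G" "v \<in> verts G" for u v
    using f(2) g(2) that by simp
  then show ?thesis unfolding graph_iso_def using bij_betw_trans[OF f(1) g(1)] by blast
qed

text \<open>Adding to \<open>S\<close> its pendant leaves gives a cut of the whole graph. A crossing
  edge cannot involve a leaf, since every leaf is on the same side as its support vertex or outside
  together with it.\<close>

lemma supports_connected:
  assumes wf: "wf_graph G" and con: "connected_graph G" and V: "verts G = supports G \<union> leaves G"
    and disj: "supports G \<inter> leaves G = {}"
    and S: "S \<subseteq> supports G" "S \<noteq> {}" "S \<noteq> supports G"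
  shows "\<exists>u\<in>S. \<exists>v\<in>supports G - S. adj G u v"
proof -
  let ?S' = "S \<union> (\<Union>v\<in>S. pendants G v)"
  have pL: "pendants G v \<subseteq> leaves G" for v by (simp add: pendants_def)
  have "?S' \<subseteq> verts G" using S(1) pL V by blast
  moreover have "?S' \<noteq> verts G" using S(1,3) pL V disj by blast
  ultimately obtain u v where uv: "u \<in> ?S'" "v \<in> verts G - ?S'" "adj G u v"
    using con S(2) unfolding connected_graph_def by (metis Un_empty)
  have "u \<in> S"
  proof (rule ccontr)
    assume "u \<notin> S"
    then obtain w where w: "w \<in> S" "u \<in> pendants G w" using uv(1) by blast
    then have "adj G u w" "u \<in> leaves G" using wf by (auto simp: pendants_def mem_nbrs adj_commute)
    then have "v = w" using leaf_nbr_unique[OF wf _ uv(3)] by blast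
    then show False using w(1) uv(2) by blast
  qed
  moreover have "v \<notin> leaves G"
  proof
    assume "v \<in> leaves G"
    then have "v \<in> pendants G u" using uv(3) wf by (simp add: pendants_def mem_nbrs)
    then show False using uv(2) \<open>u \<in> S\<close> by blast
  qed
  ultimately show ?thesis using uv V by blast
qed

lemma cospectral_jfg_iso:
  assumes p: "p \<ge> 1" and q: "q \<ge> 4" and wf: "wf_graph H" and co: "L_cospectral H (jfg p q)"
  shows "graph_iso H (jfg p q)"
proof -
  let ?J = "jfg p q" and ?C = "supports H" and ?L = "leaves H"
  note str = cospectral_jfg_structure[OF assms]
  have wfJ: "wf_graph ?J" using wf_jfg q by simp
  have irr: "\<not> adj H u u" for u by (rule adj_irrefl[OF wf])
  let ?N = "\<lambda>v. nbrs H v \<inter> ?C"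
  obtain c where c: "bij_betw c {..<card ?C} ?C"
    and Nc: "\<And>i. i < card ?C \<Longrightarrow> ?N (c i) = {c (cyc_succ (card ?C) i), c (if i = 0 then card ?C - 1 else i - 1)}"
  proof (rule two_regular_connected_cycle[of ?C ?N])
    show "?C \<noteq> {}" using str(3) q by auto
    show "u \<in> ?N v" if "u \<in> ?C" "v \<in> ?N u" for u v
      using that wf by (simp add: mem_nbrs adj_commute)
    show "v \<notin> ?N v" for v using irr wf by (simp add: mem_nbrs)
    show "\<exists>u\<in>S. \<exists>v\<in>?C - S. v \<in> ?N u" if "S \<subseteq> ?C" "S \<noteq> {}" "S \<noteq> ?C" for S
      using supports_connected[OF wf str(2,4,5) that] wf by (simp add: mem_nbrs)
    show "?N v \<subseteq> ?C \<and> card (?N v) = 2" if "v \<in> ?C" for v using str(6)[OF that] by simp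
  qed (simp, rule that)
  note cq = c[unfolded str(3)] and Ncq = Nc[unfolded str(3)]
  have cC: "c i \<in> ?C" if "i < q" for i using cq that by (auto simp: bij_betw_def)
  have c_inj: "c i = c k \<longleftrightarrow> i = k" if "i < q" "k < q" for i k
    using cq that by (auto simp: bij_betw_def inj_on_def)
  have "\<exists>e. bij_betw e {..<p} (pendants H (c i))" if "i < q" for i
    using ex_bij_betw_nat_finite[OF finite_pendants, of H "c i"] str(6)[OF cC[OF that]]
    by (simp add: atLeast0LessThan)
  then obtain e where e: "\<And>i. i < q \<Longrightarrow> bij_betw (e i) {..<p} (pendants H (c i))" by metis
  have ep: "e i j \<in> pendants H (c i)" if "i < q" "j < p" for i j
    using e[OF that(1)] that(2) by (auto simp: bij_betw_def)
  \<comment> \<open>\<open>g\<close> decodes the numbering of \<open>jfg\<close>: division with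
    remainder by \<open>p\<close> recovers the cycle position and the index of the leaf
    there.\<close>
  define g where "g k = (if k < q then c k else e ((k - q) div p) ((k - q) mod p))" for k
  have gc: "g k = c k" if "k < q" for k using that by (simp add: g_def)
  have gp: "g (q + i * p + j) = e i j" if "i < q" "j < p" for i j
    using that by (simp add: g_def)
  have g_in: "g k \<in> verts H" if "k \<in> verts ?J" for k
    using that
  proof (cases rule: verts_jfg_cases)
    case 1
    then show ?thesis using cC gc str(4) by auto
  next
    case (2 i j)
    then show ?thesis using ep[OF 2(1,2)] gp[OF 2(1,2)] str(4) by (auto simp: pendants_def)
  qed
  have "verts H \<subseteq> g ` verts ?J"
  proof
    fix v assume v: "v \<in> verts H"
    show "v \<in> g ` verts ?J"
    proof (cases "v \<in> ?C")
      case True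
      then obtain i where "i < q" "c i = v" 
        using bij_betw_imp_surj_on[OF cq] by (metis imageE lessThan_iff)
      then show ?thesis using gc by (intro image_eqI[of _ _ i]) (auto simp: verts_def)
    next
      case False
      then have l: "v \<in> ?L" using v str(4) by blast
      then have "card (nbrs H v) = 1" by (simp add: leaves_def degree_eq_card_nbrs)
      then obtain w where "nbrs H v = {w}" by (rule card_1_singletonE)
      then have w: "v \<in> pendants H w" "w \<in> verts H" using l wf adj_verts[OF wf]
        by (auto simp: pendants_def mem_nbrs[OF wf] adj_commute nbrs_def)
      then have "w \<in> ?C" by (auto simp: supports_def)
      then obtain i where i: "i < q" "c i = w" 
        using bij_betw_imp_surj_on[OF cq] by (metis imageE lessThan_iff)
      then obtain j where j: "j < p" "e i j = v" 
        using bij_betw_imp_surj_on[OF e[OF i(1)]] w(1) i(2) by (metis imageE lessThan_iff)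
      show ?thesis
        by (rule image_eqI[of _ _ "q + i * p + j"])
          (use gp[OF i(1) j(1)] j pendant_index_less[OF i(1) j(1)] in \<open>auto simp: verts_def\<close>)
    qed
  qed
  \<comment> \<open>Both vertex sets have the same finite size, so surjectivity suffices for a
    bijection.\<close>
  then have img: "g ` verts ?J = verts H" using g_in by blast
  then have "inj_on g (verts ?J)"
    using str(1) by (intro eq_card_imp_inj_on) (simp_all add: verts_def)
  with img have bij: "bij_betw g (verts ?J) (verts H)" by (simp add: bij_betw_def)
  have cyc_pend: "adj H (c u) (e i j) \<longleftrightarrow> u = i" if "u < q" "i < q" "j < p" for u i j
  proof -
    have "e i j \<in> ?L" "adj H (e i j) (c i)"
      using ep[OF that(2,3)] wf by (auto simp: pendants_def mem_nbrs adj_commute)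
    then have "adj H (e i j) (c u) \<longleftrightarrow> c u = c i"
      using leaf_nbr_unique[OF wf, of "e i j" "c u" "c i"] by auto
    then show ?thesis using c_inj that by (simp add: adj_commute)
  qed
  have cyc_pend_J: "adj ?J u (q + i * p + j) \<longleftrightarrow> u = i" if "i < q" "j < p" for u i j
    using nbrs_jfg_pendant[OF that] mem_nbrs[OF wfJ, of u "q + i * p + j"] by (simp add: adj_commute)
  have "adj ?J u v \<longleftrightarrow> adj H (g u) (g v)" if "u \<in> verts ?J" "v \<in> verts ?J" for u v
    using that(1)
  proof (cases rule: verts_jfg_cases)
    case u: 1
    show ?thesis
      using that(2)
    proof (cases rule: verts_jfg_cases)
      case v: 1
      let ?a = "cyc_succ q u" and ?b = "if u = 0 then q - 1 else u - 1"
      have ab: "?a < q" "?b < q" using u by (auto intro: mod_less_divisor)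
      have "adj ?J u v \<longleftrightarrow> v \<in> nbrs ?J u" by (simp add: mem_nbrs[OF wfJ])
      also have "\<dots> \<longleftrightarrow> v = ?a \<or> v = ?b"
        unfolding nbrs_jfg_cycle[OF u] using v by auto
      also have "\<dots> \<longleftrightarrow> c v \<in> {c ?a, c ?b}" using c_inj[OF v ab(1)] c_inj[OF v ab(2)] by blast
      also have "\<dots> \<longleftrightarrow> c v \<in> ?N (c u)" unfolding Ncq[OF u] ..
      also have "\<dots> \<longleftrightarrow> adj H (c u) (c v)" using cC[OF v] by (simp add: mem_nbrs[OF wf])
      finally show ?thesis by (simp add: gc u v)
    next
      case (2 i j)
      then show ?thesis using cyc_pend[OF u] cyc_pend_J gp gc[OF u] by metis
    qed
  next
    case u: (2 i j)
    show ?thesis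
      using that(2)
    proof (cases rule: verts_jfg_cases)
      case v: 1
      then show ?thesis using cyc_pend[OF v u(1,2)] cyc_pend_J[OF u(1,2)] gp[OF u(1,2)] gc[OF v] u(3)
        by (metis adj_commute)
    next
      case v: (2 i' j')
      have "\<not> adj ?J u v" using cyc_pend_J[OF v(1,2), of u] u(1,3) v(1,3) by simp
      moreover have "\<not> adj H (e i j) (e i' j')"
        by (rule leaf_not_adj_leaf[OF wf str(2)])
          (use str(1) q ep[OF u(1,2)] ep[OF v(1,2)] in \<open>auto simp: pendants_def\<close>)
      ultimately show ?thesis using gp u v by simp
    qed
  qed
  with bij have "graph_iso ?J H" unfolding graph_iso_def by blast
  then show ?thesis by (rule graph_iso_sym)
qed

theorem theorem3p3:
  fixes p q :: nat and H :: graph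
  assumes "p \<ge> 1" and "q \<ge> 4" and "even q"
    and "wf_graph H" and "L_cospectral H (jfg p q)"
  shows "DLS H"
  unfolding DLS_def
proof (intro allI impI)
  fix K assume K: "wf_graph K \<and> L_cospectral K H"
  then have "L_cospectral K (jfg p q)" using assms(5) by (simp add: L_cospectral_def)
  then have "graph_iso K (jfg p q)" using cospectral_jfg_iso assms(1,2) K by blast
  moreover have "graph_iso (jfg p q) H"
    by (rule graph_iso_sym[OF cospectral_jfg_iso[OF assms(1,2,4,5)]])
  ultimately show "graph_iso K H" by (rule graph_iso_trans)
qed

end
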